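(* There exist a uniformly continuous, compactly supported, weakly divergence-free velocity field $u\in C_c([0,\infty)\times\mathbb{R}^2;\mathbb{R}^2)$ and a time-dependent locally finite Borel measure $\omega=\omega(t)$ on $\mathbb{R}^2$ such that $\omega$ is weakly advected by $u$ on $[0,T]$ for every $T>0$, $\mathrm{supp}\,\omega(0)=\{(0,0)\}$, and $\dim_H\mathrm{supp}\,\omega(t)=2$ for all $t>0$. Moreover, $u$ is locally Lipschitz on $[0,\infty)\times(\mathbb{R}^2\setminus\{(0,0)\})$.
   Context: Weak advection (2D): Let $T>0$ and $u\in C([0,T]\times\mathbb{R}^2;\mathbb{R}^2)$ be continuous and weakly divergence free. A family $\mu(t)$, $t\in[0,T]$, of locally finite Borel measures on $\mathbb{R}^2$ is weakly advected by $u$ on $[0,T]$ if for every $\phi\in C_c^\infty([0,T]\times\mathbb{R}^2)$ $$\int_0^T\!\!\int\partial_t\phi(t,x)\,d\mu(t)(x)\,dt-\int\phi(T,x)\,d\mu(T)(x)+\int\phi(0,x)\,d\mu(0)(x)+\int_0^T\!\!\int (u\cdot\nabla)\phi(t,x)\,d\mu(t)(x)\,dt=0.$$ $\dim_H$ denotes Hausdorff dimension. *)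

theory Defs
  imports "HOL-Analysis.Analysis"
begin

fun iter_dderiv :: "'a::euclidean_space list \<Rightarrow> ('a \<Rightarrow> real) \<Rightarrow> ('a \<Rightarrow> real)" where
  "iter_dderiv [] f = f"
| "iter_dderiv (v # vs) f = (\<lambda>x. frechet_derivative (iter_dderiv vs f) (at x) v)"

definition smooth_fun :: "('a::euclidean_space \<Rightarrow> real) \<Rightarrow> bool" where
  "smooth_fun f \<longleftrightarrow> (\<forall>vs. set vs \<subseteq> Basis \<longrightarrow> (\<forall>x. iter_dderiv vs f differentiable (at x)))"

definition test_fun :: "('a::euclidean_space \<Rightarrow> real) \<Rightarrow> bool" where
  "test_fun f \<longleftrightarrow> smooth_fun f \<and> (\<exists>K. compact K \<and> (\<forall>x. x \<notin> K \<longrightarrow> f x = 0))"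

definition weakly_div_free :: "(real \<Rightarrow> real^2 \<Rightarrow> real^2) \<Rightarrow> bool" where
  "weakly_div_free u \<longleftrightarrow> (\<forall>t\<ge>0. \<forall>\<psi>::real^2 \<Rightarrow> real. test_fun \<psi> \<longrightarrow>
      (\<integral>x. frechet_derivative \<psi> (at x) (u t x) \<partial>lborel) = 0)"

definition locally_finite_borel :: "(real^2) measure \<Rightarrow> bool" where
  "locally_finite_borel \<mu> \<longleftrightarrow> sets \<mu> = sets borel \<and>
      (\<forall>x. \<exists>e>0. emeasure \<mu> (ball x e) < \<infinity>)"

definition weakly_advected ::
  "(real \<Rightarrow> real^2 \<Rightarrow> real^2) \<Rightarrow> (real \<Rightarrow> (real^2) measure) \<Rightarrow> real \<Rightarrow> bool" where
  "weakly_advected u \<mu> T \<longleftrightarrow>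
     (\<forall>\<phi>::real \<times> (real^2) \<Rightarrow> real. test_fun \<phi> \<longrightarrow>
        (let dt = (\<lambda>t. \<integral>x. frechet_derivative \<phi> (at (t, x)) (1, 0) \<partial>(\<mu> t));
             adv = (\<lambda>t. \<integral>x. frechet_derivative \<phi> (at (t, x)) (0, u t x) \<partial>(\<mu> t))
         in set_integrable lborel {0..T} dt \<and> set_integrable lborel {0..T} adv \<and>
            (LINT t:{0..T}|lborel. dt t) - (\<integral>x. \<phi> (T, x) \<partial>(\<mu> T))
              + (\<integral>x. \<phi> (0, x) \<partial>(\<mu> 0)) + (LINT t:{0..T}|lborel. adv t) = 0))"

definition msupp :: "'a::metric_space measure \<Rightarrow> 'a set" where
  "msupp \<mu> = {x. \<forall>e>0. emeasure \<mu> (ball x e) > 0}"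

definition hausdorff_pre :: "real \<Rightarrow> real \<Rightarrow> 'a::metric_space set \<Rightarrow> ennreal" where
  "hausdorff_pre s \<delta> A = (INF C \<in> {C :: nat \<Rightarrow> 'a set. A \<subseteq> (\<Union>i. C i) \<and>
       (\<forall>i. bounded (C i) \<and> diameter (C i) \<le> \<delta>)}. (\<Sum>i. ennreal (diameter (C i) powr s)))"

definition hausdorff_measure :: "real \<Rightarrow> 'a::metric_space set \<Rightarrow> ennreal" where
  "hausdorff_measure s A = (SUP \<delta> \<in> {0<..}. hausdorff_pre s \<delta> A)"

definition hausdorff_dim :: "'a::metric_space set \<Rightarrow> ereal" where
  "hausdorff_dim A = Inf (ereal ` {s. 0 < s \<and> hausdorff_measure s A = 0})"

definition locally_lipschitz_on :: "'a::metric_space set \<Rightarrow> ('a \<Rightarrow> 'b::metric_space) \<Rightarrow> bool" where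
  "locally_lipschitz_on S f \<longleftrightarrow> (\<forall>p\<in>S. \<exists>e>0. \<exists>L. \<forall>q\<in>S \<inter> ball p e. \<forall>r\<in>S \<inter> ball p e.
      dist (f q) (f r) \<le> L * dist q r)"

end

theory Submission
  imports Defs "HOL-Real_Asymp.Real_Asymp"
begin

text \<open>
  All particles start at the origin and fill at time \<open>t > 0\<close> a product \<open>C\<^sub>t \<times> C\<^sub>t\<close>, where \<open>C\<^sub>t\<close> is a Cantor set on
  the line of length zero and dimension one. Only the gaps of \<open>C\<^sub>t\<close> have length, and its width, the sum of
  all gap lengths, is \<open>O(t\<^sup>2)\<close>. Let \<open>v\<close> be the velocity of the particles on the line, extended over each gap with
  zero slope at the end points. Then the divergence-free field with stream function
  \<open>v(x\<^sub>1) x\<^sub>2 - x\<^sub>1 v(x\<^sub>2)\<close> is \<open>(v(x\<^sub>1), v(x\<^sub>2))\<close> on \<open>C\<^sub>t \<times> C\<^sub>t\<close>, because \<open>v'\<close> vanishes on \<open>C\<^sub>t\<close>. The slope of \<open>v\<close> is at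
  most of order \<open>1 / t\<close>, so after a cutoff at distance \<open>O(t\<^sup>2)\<close> the field is \<open>O(t)\<close>; it vanishes near \<open>(0, x)\<close>
  for \<open>x \<noteq> 0\<close>. The measure is the image of Lebesgue measure on the unit square of labels, and the
  dimension of its support is bounded below by the mass distribution principle.
\<close>

subsection \<open>Integration against test functions\<close>

text \<open>The form of the gap lengths answers to several demands at once. Length zero of the
  Cantor set is what lets v be C^1 and nonconstant with slope zero on it: all increase of v happens
  inside the gaps. The field contains v', so its Lipschitz bound involves v''. Across a gap of
  length g that opens at logarithmic rate r, the slope climbs from 0 to order r and returns to 0, so
  v'' is of order r / g; arbitrarily small gaps must not go on moving at comparable rates. Hence
  every generation stops, the finer ones earlier. On the other hand each gap starts from length 0,
  so its logarithmic rate has to blow up at time 0; quadratic growth gives 2 / t. Generation j is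
  therefore a fixed profile run at speed j + 1, quadratic at the start and constant from time 1 / (j
  + 1) on. The speed costs a factor (j + 1)^2 in the total length of the generation, and the
  division by (j + 1)^4 pays for it and leaves a convergent series. A polynomial factor is harmless
  for the dimension, since it loses against 2^(j (1 - \<alpha>)) for every exponent \<alpha> <
  1.\<close>

lemma vector_2_eq: "vector [a, b] = a *\<^sub>R axis 1 1 + b *\<^sub>R (axis 2 1 :: real^2)" for a b :: real
  by (simp add: vec_eq_iff forall_2 axis_def)

lemma continuous_on_UNIV_has_derivative:
  assumes "\<And>x. (f has_derivative f' x) (at x)"
  shows "continuous_on UNIV f"
  using assms has_derivative_continuous_on by blast

lemma has_real_derivative_along_line:
  fixes g :: "'a::real_normed_vector \<Rightarrow> real"
  assumes "\<And>x. (g has_derivative Dg x) (at x)"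
  shows "((\<lambda>s. g (x + s *\<^sub>R e)) has_real_derivative Dg (x + s *\<^sub>R e) e) (at s)"
proof -
  have "((\<lambda>s. g (x + s *\<^sub>R e)) has_derivative (\<lambda>h. Dg (x + s *\<^sub>R e) (h *\<^sub>R e))) (at s)"
    by (rule has_derivative_compose[OF _ assms]) (auto intro!: derivative_eq_intros)
  moreover have "Dg (x + s *\<^sub>R e) (h *\<^sub>R e) = Dg (x + s *\<^sub>R e) e * h" for h
    using has_derivative_bounded_linear[OF assms[of "x + s *\<^sub>R e"]]
    by (simp add: bounded_linear.linear linear_cmul)
  ultimately show ?thesis
    by (simp add: has_field_derivative_def)
qed

text \<open>Dominated convergence. The mean value theorem replaces each difference quotient by a
  value of the derivative near the support of \<open>F\<close>, which bounds it uniformly in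
  n.\<close>

lemma integral_difference_quotient_tendsto:
  fixes F g :: "'a::euclidean_space \<Rightarrow> real"
  assumes F: "continuous_on UNIV F" and K: "compact K" "\<And>x. x \<notin> K \<Longrightarrow> F x = 0"
    and g: "\<And>x. (g has_derivative Dg x) (at x)" and Dg: "continuous_on UNIV (\<lambda>x. Dg x e)"
  shows "(\<lambda>n. \<integral>x. F x * (real (Suc n) * (g (x + (1 / real (Suc n)) *\<^sub>R e) - g x)) \<partial>lborel)
           \<longlonglongrightarrow> (\<integral>x. F x * Dg x e \<partial>lborel)"
proof -
  \<comment> \<open>The union of the segments from \<open>K\<close> to its translate by
    \<open>e\<close>. The steps are at most 1, so every intermediate point of the mean value theorem
    lies in this compact set.\<close>
  define K' where "K' = (\<lambda>(x, s). x + s *\<^sub>R e) ` (K \<times> {0..1::real})"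
  have "compact K'"
    unfolding K'_def using K(1)
    by (intro compact_continuous_image compact_Times) (auto simp: case_prod_unfold intro!: continuous_intros)
  then have "bounded ((\<lambda>x. Dg x e) ` K')"
    by (intro compact_imp_bounded compact_continuous_image continuous_on_subset[OF Dg]) auto
  then obtain M where M: "\<And>y. y \<in> K' \<Longrightarrow> \<bar>Dg y e\<bar> \<le> M"
    by (auto simp: bounded_iff)
  have "bounded (F ` K)"
    using K(1) by (intro compact_imp_bounded compact_continuous_image continuous_on_subset[OF F]) auto
  then obtain L where L: "\<And>y. y \<in> K \<Longrightarrow> \<bar>F y\<bar> \<le> L"
    by (auto simp: bounded_iff)
  have [measurable]: "F \<in> borel_measurable borel" "(\<lambda>x. Dg x e) \<in> borel_measurable borel"
    using F Dg by (auto intro: borel_measurable_continuous_onI)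
  have gc: "continuous_on UNIV g"
    by (rule continuous_on_UNIV_has_derivative[OF g])
  have [measurable]: "g \<in> borel_measurable borel"
    using gc by (rule borel_measurable_continuous_onI)
  show ?thesis
  proof (rule integral_dominated_convergence[where w = "\<lambda>x. indicator K x * (L * M)"])
    show "AE x in lborel. (\<lambda>n. F x * (real (Suc n) * (g (x + (1 / real (Suc n)) *\<^sub>R e) - g x)))
            \<longlonglongrightarrow> F x * Dg x e"
    proof (intro AE_I2 tendsto_mult tendsto_const)
      fix x
      have "((\<lambda>h. (g (x + h *\<^sub>R e) - g x) / h) \<longlongrightarrow> Dg x e) (at 0)"
        using has_real_derivative_along_line[OF g, of x e 0]
        by (simp add: has_field_derivative_iff)
      moreover have "filterlim (\<lambda>n. 1 / real (Suc n)) (at 0) sequentially"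
        using lim_1_over_real_power[of 1] LIMSEQ_inverse_real_of_nat
        by (auto simp: filterlim_at inverse_eq_divide)
      ultimately have "(\<lambda>n. (g (x + (1 / real (Suc n)) *\<^sub>R e) - g x) / (1 / real (Suc n))) \<longlonglongrightarrow> Dg x e"
        by (rule filterlim_compose)
      then show "(\<lambda>n. real (Suc n) * (g (x + (1 / real (Suc n)) *\<^sub>R e) - g x)) \<longlonglongrightarrow> Dg x e"
        by (simp add: mult.commute)
    qed
    fix n
    show "AE x in lborel. norm (F x * (real (Suc n) * (g (x + (1 / real (Suc n)) *\<^sub>R e) - g x)))
            \<le> indicator K x * (L * M)"
    proof (rule AE_I2)
      fix x
      show "norm (F x * (real (Suc n) * (g (x + (1 / real (Suc n)) *\<^sub>R e) - g x)))
            \<le> indicator K x * (L * M)"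
      proof (cases "x \<in> K")
        case True
        define h where "h = 1 / real (Suc n)"
        have h: "0 < h" "h \<le> 1" "real (Suc n) = 1 / h"
          by (auto simp: h_def)
        obtain z where z: "0 < z" "z < h"
          "g (x + h *\<^sub>R e) - g (x + 0 *\<^sub>R e) = (h - 0) * Dg (x + z *\<^sub>R e) e"
          using MVT2[OF h(1), of "\<lambda>s. g (x + s *\<^sub>R e)" "\<lambda>s. Dg (x + s *\<^sub>R e) e"]
            has_real_derivative_along_line[OF g] by blast
        have "x + z *\<^sub>R e \<in> K'"
          unfolding K'_def using True z h by (intro image_eqI[of _ _ "(x, z)"]) auto
        then have "\<bar>Dg (x + z *\<^sub>R e) e\<bar> \<le> M" by (rule M)
        moreover have "real (Suc n) * (g (x + h *\<^sub>R e) - g x) = Dg (x + z *\<^sub>R e) e"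
          using z(3) h(1) unfolding h(3) by simp
        ultimately show ?thesis
          using True L[OF True] unfolding h_def[symmetric]
          by (auto simp: abs_mult intro!: mult_mono)
      qed (simp add: K(2))
    qed
    show "integrable lborel (\<lambda>x. indicator K x * (L * M))"
      using K(1) emeasure_bounded_finite[OF compact_imp_bounded[OF K(1)]]
      by (intro integrable_mult_left integrable_real_indicator) (auto intro: borel_compact)
  qed auto
qed

lemma lborel_integral_translation:
  fixes f :: "'a::euclidean_space \<Rightarrow> real"
  assumes [measurable]: "f \<in> borel_measurable borel"
  shows "(\<integral>x. f (c + x) \<partial>lborel) = (\<integral>x. f x \<partial>lborel)"
  by (subst (2) lborel_distr_plus[of c, symmetric]) (simp add: integral_distr)

lemma integrable_continuous_compact_support:
  fixes f :: "'a::euclidean_space \<Rightarrow> real"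
  assumes "continuous_on UNIV f" "compact K" "\<And>x. x \<notin> K \<Longrightarrow> f x = 0"
  shows "integrable lborel f"
proof -
  have "set_integrable lborel K f"
    unfolding set_integrable_def
    using assms(2) by (intro borel_integrable_compact continuous_on_subset[OF assms(1)]) auto
  moreover have "(\<lambda>x. indicator K x *\<^sub>R f x) = f"
    using assms(3) by (auto simp: indicator_def fun_eq_iff)
  ultimately show ?thesis by (simp add: set_integrable_def)
qed

text \<open>Translation invariance of the integral moves a difference quotient in direction
  \<open>e\<close> from \<open>g\<close> to one in direction \<open>- e\<close> on \<open>F\<close>;
  passing to the limit on both sides gives the formula.\<close>

lemma integral_by_parts_compact_support:
  fixes F g :: "'a::euclidean_space \<Rightarrow> real"
  assumes F: "\<And>x. (F has_derivative DF x) (at x)" and DF: "continuous_on UNIV (\<lambda>x. DF x e)"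
    and K: "compact K" "\<And>x. x \<notin> K \<Longrightarrow> F x = 0"
    and g: "\<And>x. (g has_derivative Dg x) (at x)" and Dg: "continuous_on UNIV (\<lambda>x. Dg x e)"
    and C: "compact C" "\<And>x. x \<notin> C \<Longrightarrow> g x = 0"
  shows "(\<integral>x. F x * Dg x e \<partial>lborel) = - (\<integral>x. g x * DF x e \<partial>lborel)"
proof -
  have Fc: "continuous_on UNIV F" and gc: "continuous_on UNIV g"
    by (rule continuous_on_UNIV_has_derivative[OF F], rule continuous_on_UNIV_has_derivative[OF g])
  have lin: "DF x (- e) = - DF x e" for x
    using has_derivative_bounded_linear[OF F[of x]] by (simp add: bounded_linear.linear linear_neg)
  have 1: "(\<lambda>n. \<integral>x. F x * (real (Suc n) * (g (x + (1 / real (Suc n)) *\<^sub>R e) - g x)) \<partial>lborel)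
           \<longlonglongrightarrow> (\<integral>x. F x * Dg x e \<partial>lborel)"
    by (rule integral_difference_quotient_tendsto[OF Fc K g Dg])
  have "continuous_on UNIV (\<lambda>x. DF x (- e))"
    unfolding lin by (intro continuous_intros DF)
  note DF' = this
  have 2: "(\<lambda>n. \<integral>x. g x * (real (Suc n) * (F (x + (1 / real (Suc n)) *\<^sub>R (- e)) - F x)) \<partial>lborel)
           \<longlonglongrightarrow> (\<integral>x. g x * DF x (- e) \<partial>lborel)"
    by (rule integral_difference_quotient_tendsto[OF gc C F DF'])
  have "(\<integral>x. F x * (real (Suc n) * (g (x + (1 / real (Suc n)) *\<^sub>R e) - g x)) \<partial>lborel)
      = (\<integral>x. g x * (real (Suc n) * (F (x + (1 / real (Suc n)) *\<^sub>R (- e)) - F x)) \<partial>lborel)" for n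
  proof -
    define h where "h = (1 / real (Suc n)) *\<^sub>R e"
    define m where "m = real (Suc n)"
    have m: "m > 0" by (simp add: m_def)
    have i1: "integrable lborel (\<lambda>x. m * (F x * g x))" 
      by (rule integrable_continuous_compact_support[OF _ K(1)]) (auto intro!: continuous_intros Fc gc simp: K)
    have i2: "integrable lborel (\<lambda>x. m * (F x * g (x + h)))" 
      by (rule integrable_continuous_compact_support[OF _ K(1)])
         (auto intro!: continuous_intros Fc continuous_on_compose2[OF gc] simp: K)
    have i3: "integrable lborel (\<lambda>x. m * (F (x - h) * g x))" 
      by (rule integrable_continuous_compact_support[OF _ C(1)])
         (auto intro!: continuous_intros gc continuous_on_compose2[OF Fc] simp: C)
    have [measurable]: "F \<in> borel_measurable borel" "g \<in> borel_measurable borel"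
      using Fc gc by (auto intro: borel_measurable_continuous_onI)
    have "(\<integral>x. m * (F x * g (x + h)) \<partial>lborel) = (\<integral>x. m * (F (x - h) * g x) \<partial>lborel)"
      using lborel_integral_translation[of "\<lambda>x. m * (F (x - h) * g x)" h] by (simp add: add.commute)
    then have "(\<integral>x. m * (F x * g (x + h)) - m * (F x * g x) \<partial>lborel)
      = (\<integral>x. m * (F (x - h) * g x) - m * (F x * g x) \<partial>lborel)"
      using i1 i2 i3 by simp
    then show ?thesis
      unfolding m_def[symmetric] by (simp add: h_def m_def algebra_simps)
  qed
  with 1 2 have "(\<integral>x. F x * Dg x e \<partial>lborel) = (\<integral>x. g x * DF x (- e) \<partial>lborel)"
    using LIMSEQ_unique by simp
  then show ?thesis by (simp add: lin)
qed

section \<open>Derivatives of test functions\<close>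

lemma test_fun_compact_supportE:
  assumes "test_fun \<phi>"
  obtains K where "compact K" "\<And>x. x \<notin> K \<Longrightarrow> \<phi> x = 0"
    "\<And>x v. x \<notin> K \<Longrightarrow> frechet_derivative \<phi> (at x) v = 0"
proof -
  obtain K where K: "compact K" "\<And>x. x \<notin> K \<Longrightarrow> \<phi> x = 0"
    using assms by (auto simp: test_fun_def)
  have "frechet_derivative \<phi> (at x) v = 0" if "x \<notin> K" for x v
  proof -
    have "open (- K)" using K(1) by (simp add: compact_imp_closed open_Compl)
    have "((\<lambda>_. 0) has_derivative (\<lambda>_. 0)) (at x)"
      by simp
    then have "(\<phi> has_derivative (\<lambda>_. 0)) (at x)"
      by (rule has_derivative_transform_within_open[OF _ \<open>open (- K)\<close>]) (use that K in auto)
    then show ?thesis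
      using frechet_derivative_at by metis
  qed
  with K that show thesis by blast
qed

lemma test_fun_has_derivative:
  assumes "test_fun \<phi>"
  shows "(\<phi> has_derivative frechet_derivative \<phi> (at x)) (at x)"
proof -
  have "iter_dderiv [] \<phi> differentiable (at x)"
    using assms unfolding test_fun_def smooth_fun_def by (metis empty_iff list.set(1) subsetI)
  then show ?thesis
    by (simp add: frechet_derivative_works)
qed

lemma test_fun_Basis_derivative_has_derivative:
  assumes "test_fun \<phi>" "e \<in> Basis"
  shows "((\<lambda>x. frechet_derivative \<phi> (at x) e) has_derivative
           frechet_derivative (\<lambda>x. frechet_derivative \<phi> (at x) e) (at x)) (at x)"
proof -
  have "set [e] \<subseteq> Basis" using assms(2) by simp
  then have "iter_dderiv [e] \<phi> differentiable (at x)"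
    using assms(1) unfolding test_fun_def smooth_fun_def by blast
  then show ?thesis
    by (simp add: frechet_derivative_works)
qed

text \<open>\<open>smooth_fun\<close> asserts differentiability only; continuity of a derivative
  comes from its being differentiable in turn.\<close>

lemma test_fun_Basis_second_derivative_continuous:
  assumes "test_fun \<phi>" "e \<in> Basis" "e' \<in> Basis"
  shows "continuous_on UNIV (\<lambda>x. frechet_derivative (\<lambda>x. frechet_derivative \<phi> (at x) e) (at x) e')"
proof -
  have "set [e', e] \<subseteq> Basis" using assms(2,3) by simp
  then have "iter_dderiv [e', e] \<phi> differentiable (at x)" for x
    using assms(1) unfolding test_fun_def smooth_fun_def by blast
  then show ?thesis
    by (intro differentiable_imp_continuous_on)
       (auto simp: differentiable_on_def intro: differentiable_at_withinI)
qed

lemma test_fun_derivative_continuous: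
  assumes "test_fun \<phi>"
  shows "continuous_on UNIV (\<lambda>x. frechet_derivative \<phi> (at x) v)"
proof -
  \<comment> \<open>\<open>smooth_fun\<close> controls only the directions in \<open>Basis\<close>,
    so a general direction is expanded in the basis first.\<close>
  have "frechet_derivative \<phi> (at x) v = (\<Sum>e\<in>Basis. (v \<bullet> e) * frechet_derivative \<phi> (at x) e)" for x
  proof -
    have "linear (frechet_derivative \<phi> (at x))"
      using has_derivative_bounded_linear[OF test_fun_has_derivative[OF assms]]
      by (rule bounded_linear.linear)
    then have "frechet_derivative \<phi> (at x) (\<Sum>e\<in>Basis. (v \<bullet> e) *\<^sub>R e)
        = (\<Sum>e\<in>Basis. (v \<bullet> e) *\<^sub>R frechet_derivative \<phi> (at x) e)"
      by (simp add: linear_sum linear_cmul)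
    then show ?thesis by (simp add: euclidean_representation)
  qed
  moreover have "continuous_on UNIV (\<lambda>x. frechet_derivative \<phi> (at x) e)" if "e \<in> Basis" for e
    by (rule continuous_on_UNIV_has_derivative[OF test_fun_Basis_derivative_has_derivative[OF assms that]])
  ultimately show ?thesis
    by (auto intro!: continuous_intros)
qed

text \<open>Only \<open>\<phi>\<close> has second derivatives. Integrating by parts against a difference quotient of \<open>\<phi>\<close>,
  instead of its derivative, avoids both second derivatives of \<open>\<psi>\<close> and the symmetry of those of \<open>\<phi>\<close>.\<close>

lemma integral_skew_gradient_test_fun:
  fixes \<psi> :: "real^2 \<Rightarrow> real"
  assumes \<psi>: "\<And>x. (\<psi> has_derivative D\<psi> x) (at x)"
    and D: "\<And>e. e \<in> Basis \<Longrightarrow> continuous_on UNIV (\<lambda>x. D\<psi> x e)"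
    and K: "compact K" "\<And>x. x \<notin> K \<Longrightarrow> \<psi> x = 0"
    and \<phi>: "test_fun \<phi>"
  shows "(\<integral>x. frechet_derivative \<phi> (at x) (vector [D\<psi> x (axis 2 1), - D\<psi> x (axis 1 1)]) \<partial>lborel) = 0"
proof -
  define D\<phi> where "D\<phi> x = frechet_derivative \<phi> (at x)" for x
  obtain C where C: "compact C" "\<And>x. x \<notin> C \<Longrightarrow> \<phi> x = 0" "\<And>x v. x \<notin> C \<Longrightarrow> D\<phi> x v = 0"
    unfolding D\<phi>_def using test_fun_compact_supportE[OF \<phi>] by blast
  define e1 e2 :: "real^2" where "e1 = axis 1 1" and "e2 = axis 2 1"
  have e: "e1 \<in> Basis" "e2 \<in> Basis" by (auto simp: e1_def e2_def axis_in_Basis_iff)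
  have d\<phi>: "(\<phi> has_derivative D\<phi> x) (at x)" for x
    unfolding D\<phi>_def by (rule test_fun_has_derivative[OF \<phi>])
  have cD\<phi>: "continuous_on UNIV (\<lambda>x. D\<phi> x v)" for v
    unfolding D\<phi>_def by (rule test_fun_derivative_continuous[OF \<phi>])
  define DD where "DD x = frechet_derivative (\<lambda>x. D\<phi> x e2) (at x)" for x
  have dD: "((\<lambda>x. D\<phi> x e2) has_derivative DD x) (at x)" for x
    unfolding DD_def D\<phi>_def by (rule test_fun_Basis_derivative_has_derivative[OF \<phi> e(2)])
  have cDD: "continuous_on UNIV (\<lambda>x. DD x e1)"
    unfolding DD_def D\<phi>_def by (rule test_fun_Basis_second_derivative_continuous[OF \<phi> e(2,1)])
  have c\<psi>: "continuous_on UNIV \<psi>"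
    by (rule continuous_on_UNIV_has_derivative[OF \<psi>])
  have K0: "D\<psi> x v = 0" if "x \<notin> K" for x v
  proof -
    have "open (- K)" using K(1) by (simp add: compact_imp_closed open_Compl)
    have "((\<lambda>_. 0) has_derivative (\<lambda>_. 0)) (at x)"
      by simp
    then have "(\<psi> has_derivative (\<lambda>_. 0)) (at x)"
      by (rule has_derivative_transform_within_open[OF _ \<open>open (- K)\<close>]) (use that K in auto)
    then show ?thesis
      using has_derivative_unique[OF \<psi>[of x]] by metis
  qed
  define \<Delta> where "\<Delta> n f x = real (Suc n) * (f (x + (1 / real (Suc n)) *\<^sub>R e1) - f x)"
    for n and f :: "real^2 \<Rightarrow> real" and x
  have l1: "(\<lambda>n. \<integral>x. D\<psi> x e2 * \<Delta> n \<phi> x \<partial>lborel) \<longlonglongrightarrow> (\<integral>x. D\<psi> x e2 * D\<phi> x e1 \<partial>lborel)"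
    unfolding \<Delta>_def by (rule integral_difference_quotient_tendsto[OF D[OF e(2)] K(1) K0 d\<phi> cD\<phi>])
  have l2: "(\<lambda>n. \<integral>x. \<psi> x * \<Delta> n (\<lambda>x. D\<phi> x e2) x \<partial>lborel) \<longlonglongrightarrow> (\<integral>x. \<psi> x * DD x e1 \<partial>lborel)"
    unfolding \<Delta>_def by (rule integral_difference_quotient_tendsto[OF c\<psi> K dD cDD])
  \<comment> \<open>The quotient in direction \<open>e1\<close> commutes with differentiation in
    direction \<open>e2\<close>, so the left factor is the \<open>e2\<close>-derivative of
    \<open>\<Delta> n \<phi>\<close>, and one integration by parts moves that derivative to
    \<psi>.\<close>
  have "(\<integral>x. \<psi> x * \<Delta> n (\<lambda>x. D\<phi> x e2) x \<partial>lborel) = - (\<integral>x. D\<psi> x e2 * \<Delta> n \<phi> x \<partial>lborel)" for n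
  proof -
    define h where "h = (1 / real (Suc n)) *\<^sub>R e1"
    have "(\<phi> \<circ> (\<lambda>x. x + h) has_derivative D\<phi> (x + h) \<circ> (\<lambda>v. v)) (at x)" for x
      by (rule diff_chain_at[OF _ d\<phi>]) (auto intro!: derivative_eq_intros)
    then have sh: "((\<lambda>x. \<phi> (x + h)) has_derivative D\<phi> (x + h)) (at x)" for x
      by (simp add: comp_def)
    have dd: "(\<Delta> n \<phi> has_derivative (\<lambda>v. real (Suc n) * (D\<phi> (x + h) v - D\<phi> x v))) (at x)" for x
      unfolding \<Delta>_def h_def[symmetric] by (intro derivative_intros sh d\<phi>)
    have cc: "continuous_on UNIV (\<lambda>x. real (Suc n) * (D\<phi> (x + h) e2 - D\<phi> x e2))"
      by (intro continuous_intros cD\<phi> continuous_on_compose2[OF cD\<phi>]) auto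
    have cp: "compact (C \<union> (\<lambda>x. x - h) ` C)"
      using C(1) by (intro compact_Un compact_continuous_image continuous_intros) auto
    have "\<Delta> n \<phi> x = 0" if x: "x \<notin> C \<union> (\<lambda>x. x - h) ` C" for x
    proof -
      have "x + h \<notin> C" using x by (force simp: image_iff)
      with x show ?thesis unfolding \<Delta>_def h_def[symmetric] by (simp add: C)
    qed
    from integral_by_parts_compact_support[OF \<psi> D[OF e(2)] K dd cc cp this]
    show ?thesis
      unfolding \<Delta>_def[of n "\<lambda>x. D\<phi> x e2"] h_def[symmetric] by (simp add: mult.commute)
  qed
  then have "(\<lambda>n. \<integral>x. \<psi> x * \<Delta> n (\<lambda>x. D\<phi> x e2) x \<partial>lborel) \<longlonglongrightarrow> - (\<integral>x. D\<psi> x e2 * D\<phi> x e1 \<partial>lborel)"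
    using tendsto_minus[OF l1] by simp
  with l2 have "(\<integral>x. \<psi> x * DD x e1 \<partial>lborel) = - (\<integral>x. D\<psi> x e2 * D\<phi> x e1 \<partial>lborel)"
    by (rule LIMSEQ_unique)
  \<comment> \<open>The same integral evaluated a second way: now the derivative in direction
    \<open>e1\<close> is moved to \<psi>. Comparing the two values gives the cancellation of the
    skew gradient.\<close>
  moreover have "(\<integral>x. \<psi> x * DD x e1 \<partial>lborel) = - (\<integral>x. D\<phi> x e2 * D\<psi> x e1 \<partial>lborel)"
    by (rule integral_by_parts_compact_support[OF \<psi> D[OF e(1)] K dD cDD C(1) C(3)])
  ultimately have eq: "(\<integral>x. D\<psi> x e2 * D\<phi> x e1 \<partial>lborel) = (\<integral>x. D\<phi> x e2 * D\<psi> x e1 \<partial>lborel)"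
    by simp
  have exp: "D\<phi> x (vector [D\<psi> x e2, - D\<psi> x e1]) = D\<psi> x e2 * D\<phi> x e1 - D\<phi> x e2 * D\<psi> x e1" for x
  proof -
    have lin: "linear (D\<phi> x)"
      by (rule bounded_linear.linear[OF has_derivative_bounded_linear[OF d\<phi>]])
    have "vector [a, b] = a *\<^sub>R e1 + b *\<^sub>R e2" for a b :: real
      by (simp add: vector_2_eq e1_def e2_def)
    then show ?thesis
      by (simp add: linear_add[OF lin] linear_cmul[OF lin] linear_diff[OF lin])
  qed
  have "integrable lborel (\<lambda>x. D\<psi> x e2 * D\<phi> x e1)" "integrable lborel (\<lambda>x. D\<phi> x e2 * D\<psi> x e1)"
    by (rule integrable_continuous_compact_support[OF _ C(1)];
        simp add: C(3) continuous_on_mult D[OF e(1)] D[OF e(2)] cD\<phi>)+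
  then have "(\<integral>x. D\<phi> x (vector [D\<psi> x e2, - D\<psi> x e1]) \<partial>lborel) = 0"
    unfolding exp using eq by simp
  then show ?thesis by (simp add: D\<phi>_def e1_def e2_def)
qed

subsection \<open>Local Lipschitz continuity\<close>

text \<open>A pointwise notion that is stable under arithmetic and composition, so explicit formulas
  are settled by a list of rules. The ball is taken in the whole space, which suits the field at
  positive times; time 0 is treated separately.\<close>

definition lipschitz_near :: "'a::metric_space \<Rightarrow> ('a \<Rightarrow> 'b::metric_space) \<Rightarrow> bool" where
  "lipschitz_near p f \<longleftrightarrow> (\<exists>e>0. \<exists>L. L-lipschitz_on (ball p e) f)"

lemma lipschitz_nearE:
  assumes "lipschitz_near p f"
  obtains e L where "e > 0" "L > 0" "L-lipschitz_on (ball p e) f"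
proof -
  from assms obtain e L where "e > 0" "L-lipschitz_on (ball p e) f"
    by (auto simp: lipschitz_near_def)
  then have "(max L 1)-lipschitz_on (ball p e) f"
    by (auto intro: lipschitz_on_mono)
  with \<open>e > 0\<close> that show thesis by (metis less_max_iff_disj zero_less_one)
qed

lemma lipschitz_nearI: "L-lipschitz_on UNIV f \<Longrightarrow> lipschitz_near p f"
  unfolding lipschitz_near_def by (meson lipschitz_on_subset subset_UNIV zero_less_one)

lemma lipschitz_near_common:
  assumes "lipschitz_near p f" "lipschitz_near p g"
  obtains e L M where "e > 0" "L > 0" "M > 0" "L-lipschitz_on (ball p e) f" "M-lipschitz_on (ball p e) g"
proof -
  obtain e L where 1: "e > 0" "L > 0" "L-lipschitz_on (ball p e) f"
    using lipschitz_nearE[OF assms(1)] by blast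
  obtain d M where 2: "d > 0" "M > 0" "M-lipschitz_on (ball p d) g"
    using lipschitz_nearE[OF assms(2)] by blast
  have "L-lipschitz_on (ball p (min e d)) f" "M-lipschitz_on (ball p (min e d)) g"
    by (rule lipschitz_on_subset[OF 1(3)] lipschitz_on_subset[OF 2(3)], simp add: subset_ball)+
  with 1 2 that[of "min e d" L M] show thesis by simp
qed

lemma lipschitz_near_const [simp]: "lipschitz_near p (\<lambda>_. c)"
  by (rule lipschitz_nearI[OF lipschitz_on_constant])

lemma lipschitz_near_fst: "lipschitz_near p fst"
  by (rule lipschitz_nearI[of 1]) (simp add: lipschitz_on_def dist_fst_le)

lemma lipschitz_near_snd: "lipschitz_near p snd"
  by (rule lipschitz_nearI[of 1]) (simp add: lipschitz_on_def dist_snd_le)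

lemma lipschitz_near_compose:
  assumes "lipschitz_near p f" "lipschitz_near (f p) g"
  shows "lipschitz_near p (\<lambda>x. g (f x))"
proof -
  obtain e L where 1: "e > 0" "L > 0" "L-lipschitz_on (ball p e) f"
    using lipschitz_nearE[OF assms(1)] by blast
  obtain d M where 2: "d > 0" "M > 0" "M-lipschitz_on (ball (f p) d) g"
    using lipschitz_nearE[OF assms(2)] by blast
  define r where "r = min e (d / L)"
  have r: "r > 0" using 1 2 by (simp add: r_def)
  have sub: "f ` ball p r \<subseteq> ball (f p) d"
  proof safe
    fix x assume "x \<in> ball p r"
    then have x: "dist p x < e" "dist p x < d / L" by (auto simp: r_def)
    have "dist (f p) (f x) \<le> L * dist p x"
      using lipschitz_onD[OF 1(3)] x(1) 1(1) by simp
    also have "\<dots> < d" using x(2) 1(2) by (simp add: field_simps)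
    finally show "f x \<in> ball (f p) d" by simp
  qed
  have "L-lipschitz_on (ball p r) f"
    by (rule lipschitz_on_subset[OF 1(3)]) (simp add: subset_ball r_def)
  then have "(M * L)-lipschitz_on (ball p r) (\<lambda>x. g (f x))"
    using lipschitz_on_compose2 lipschitz_on_subset[OF 2(3) sub] by blast
  with r show ?thesis by (auto simp: lipschitz_near_def)
qed

lemma lipschitz_near_Pair:
  assumes "lipschitz_near p f" "lipschitz_near p g"
  shows "lipschitz_near p (\<lambda>x. (f x, g x))"
proof -
  obtain e L M where *: "e > 0" "L > 0" "M > 0" "L-lipschitz_on (ball p e) f" "M-lipschitz_on (ball p e) g"
    using lipschitz_near_common[OF assms] .
  then show ?thesis
    unfolding lipschitz_near_def using lipschitz_on_Pair[OF *(4,5)] by blast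
qed

lemma lipschitz_near_add:
  fixes f g :: "'a::metric_space \<Rightarrow> 'b::real_normed_vector"
  assumes "lipschitz_near p f" "lipschitz_near p g"
  shows "lipschitz_near p (\<lambda>x. f x + g x)"
proof -
  obtain e L M where *: "e > 0" "L > 0" "M > 0" "L-lipschitz_on (ball p e) f" "M-lipschitz_on (ball p e) g"
    using lipschitz_near_common[OF assms] .
  then show ?thesis
    unfolding lipschitz_near_def using lipschitz_on_add[OF *(4,5)] by blast
qed

lemma lipschitz_near_minus:
  fixes f :: "'a::metric_space \<Rightarrow> 'b::real_normed_vector"
  assumes "lipschitz_near p f"
  shows "lipschitz_near p (\<lambda>x. - f x)"
  using assms unfolding lipschitz_near_def by simp

lemma lipschitz_near_diff:
  fixes f g :: "'a::metric_space \<Rightarrow> 'b::real_normed_vector"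
  assumes "lipschitz_near p f" "lipschitz_near p g"
  shows "lipschitz_near p (\<lambda>x. f x - g x)"
  using lipschitz_near_add[OF assms(1) lipschitz_near_minus[OF assms(2)]] by simp

lemma lipschitz_near_sum:
  fixes f :: "'i \<Rightarrow> 'a::metric_space \<Rightarrow> 'b::real_normed_vector"
  assumes "\<And>i. i \<in> I \<Longrightarrow> lipschitz_near p (f i)"
  shows "lipschitz_near p (\<lambda>x. \<Sum>i\<in>I. f i x)"
  using assms
  by (induction I rule: infinite_finite_induct) (auto intro: lipschitz_near_add)

lemma lipschitz_near_mult:
  fixes f g :: "'a::metric_space \<Rightarrow> real"
  assumes "lipschitz_near p f" "lipschitz_near p g"
  shows "lipschitz_near p (\<lambda>x. f x * g x)"
proof -
  obtain e L M where *: "e > 0" "L > 0" "M > 0" "L-lipschitz_on (ball p e) f" "M-lipschitz_on (ball p e) g"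
    using lipschitz_near_common[OF assms] .
  define A where "A = \<bar>f p\<bar> + L * e"
  define B where "B = \<bar>g p\<bar> + M * e"
  have AB: "A \<ge> 0" "B \<ge> 0" using * by (auto simp: A_def B_def)
  have fA: "\<bar>f x\<bar> \<le> A" if "x \<in> ball p e" for x
  proof -
    have "dist (f p) (f x) \<le> L * dist p x" using lipschitz_onD[OF *(4)] that *(1) by simp
    also have "\<dots> \<le> L * e" using that * by (intro mult_left_mono) auto
    finally show ?thesis by (auto simp: A_def dist_real_def)
  qed
  have gB: "\<bar>g x\<bar> \<le> B" if "x \<in> ball p e" for x
  proof -
    have "dist (g p) (g x) \<le> M * dist p x" using lipschitz_onD[OF *(5)] that *(1) by simp
    also have "\<dots> \<le> M * e" using that * by (intro mult_left_mono) auto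
    finally show ?thesis by (auto simp: B_def dist_real_def)
  qed
  have "(A * M + B * L)-lipschitz_on (ball p e) (\<lambda>x. f x * g x)"
  proof (rule lipschitz_onI)
    fix x y assume xy: "x \<in> ball p e" "y \<in> ball p e"
    have "dist (f x * g x) (f y * g y) = \<bar>f x * (g x - g y) + g y * (f x - f y)\<bar>"
      by (simp add: dist_real_def algebra_simps)
    also have "\<dots> \<le> \<bar>f x\<bar> * \<bar>g x - g y\<bar> + \<bar>g y\<bar> * \<bar>f x - f y\<bar>"
      by (metis abs_mult abs_triangle_ineq)
    also have "\<dots> \<le> A * (M * dist x y) + B * (L * dist x y)"
      using lipschitz_onD[OF *(4) xy] lipschitz_onD[OF *(5) xy] fA[OF xy(1)] gB[OF xy(2)] AB
      by (intro add_mono mult_mono) (auto simp: dist_real_def)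
    finally show "dist (f x * g x) (f y * g y) \<le> (A * M + B * L) * dist x y"
      by (simp add: algebra_simps)
  qed (use AB * in auto)
  with *(1) show ?thesis by (auto simp: lipschitz_near_def)
qed

lemma lipschitz_near_inverse:
  fixes c :: real
  assumes "c \<noteq> 0"
  shows "lipschitz_near c inverse"
proof -
  \<comment> \<open>On this ball both arguments have modulus at least |c| / 2, and the difference of
    the inverses is the difference of the arguments divided by their product.\<close>
  have "(4 / c\<^sup>2)-lipschitz_on (ball c (\<bar>c\<bar> / 2)) inverse"
  proof (rule lipschitz_onI)
    fix x y assume "x \<in> ball c (\<bar>c\<bar> / 2)" "y \<in> ball c (\<bar>c\<bar> / 2)"
    then have "\<bar>c - x\<bar> < \<bar>c\<bar> / 2" "\<bar>c - y\<bar> < \<bar>c\<bar> / 2" by (simp_all add: dist_real_def)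
    then have xy: "\<bar>x\<bar> \<ge> \<bar>c\<bar> / 2" "\<bar>y\<bar> \<ge> \<bar>c\<bar> / 2" by linarith+
    then have nz: "x \<noteq> 0" "y \<noteq> 0" using assms by auto
    have "c\<^sup>2 / 4 = (\<bar>c\<bar> / 2) * (\<bar>c\<bar> / 2)" by (simp add: power2_eq_square)
    also have "\<dots> \<le> \<bar>x\<bar> * \<bar>y\<bar>" using xy by (intro mult_mono) auto
    finally have "1 / (\<bar>x\<bar> * \<bar>y\<bar>) \<le> 1 / (c\<^sup>2 / 4)"
      using assms nz by (intro divide_left_mono mult_pos_pos) auto
    then have "\<bar>x - y\<bar> * (1 / (\<bar>x\<bar> * \<bar>y\<bar>)) \<le> \<bar>x - y\<bar> * (1 / (c\<^sup>2 / 4))"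
      by (intro mult_left_mono) auto
    moreover have "dist (inverse x) (inverse y) = \<bar>x - y\<bar> * (1 / (\<bar>x\<bar> * \<bar>y\<bar>))"
    proof -
      have "inverse x - inverse y = (y - x) / (x * y)" using nz by (simp add: field_simps)
      then show ?thesis by (simp add: dist_real_def abs_mult abs_minus_commute)
    qed
    ultimately show "dist (inverse x) (inverse y) \<le> 4 / c\<^sup>2 * dist x y"
      by (simp add: dist_real_def field_simps)
  qed simp
  with assms show ?thesis
    unfolding lipschitz_near_def by (intro exI[of _ "\<bar>c\<bar> / 2"]) auto
qed

lemma lipschitz_near_divide:
  fixes f g :: "'a::metric_space \<Rightarrow> real"
  assumes "lipschitz_near p f" "lipschitz_near p g" "g p \<noteq> 0"
  shows "lipschitz_near p (\<lambda>x. f x / g x)"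
  using lipschitz_near_mult[OF assms(1) lipschitz_near_compose[OF assms(2) lipschitz_near_inverse[OF assms(3)]]]
  by (simp add: divide_inverse)

lemma lipschitz_near_transform:
  assumes "lipschitz_near p f" "open U" "p \<in> U" "\<And>x. x \<in> U \<Longrightarrow> f x = g x"
  shows "lipschitz_near p g"
proof -
  obtain e L where 1: "e > 0" "L > 0" "L-lipschitz_on (ball p e) f"
    using lipschitz_nearE[OF assms(1)] by blast
  obtain d where d: "d > 0" "ball p d \<subseteq> U" using assms(2,3) openE by blast
  have "L-lipschitz_on (ball p (min e d)) f"
    by (rule lipschitz_on_subset[OF 1(3)]) (simp add: subset_ball)
  moreover have "f x = g x" if "x \<in> ball p (min e d)" for x
    using that d(2) assms(4) by auto
  ultimately have "L-lipschitz_on (ball p (min e d)) g"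
    by (metis lipschitz_on_transform)
  with 1(1) d(1) show ?thesis unfolding lipschitz_near_def by (metis min_less_iff_conj)
qed

lemma lipschitz_near_imp_continuous:
  assumes "lipschitz_near p f"
  shows "isCont f p"
proof -
  obtain e L where 1: "e > 0" "L > 0" "L-lipschitz_on (ball p e) f"
    using lipschitz_nearE[OF assms(1)] by blast
  from lipschitz_on_continuous_on[OF 1(3)] 1(1) show ?thesis
    by (simp add: continuous_on_interior interior_open)
qed

lemma lipschitz_near_vec_component: "lipschitz_near p (\<lambda>x :: real^'n. x $ i)"
  by (rule lipschitz_nearI[of 1]) (simp add: lipschitz_on_def dist_vec_nth_le)

lemma lipschitz_near_vector_2:
  fixes f g :: "'a::metric_space \<Rightarrow> real"
  assumes "lipschitz_near p f" "lipschitz_near p g"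
  shows "lipschitz_near p (\<lambda>x. vector [f x, g x] :: real^2)"
proof -
  have sm: "lipschitz_near p (\<lambda>x. f x *\<^sub>R v)" if f: "lipschitz_near p f" for f and v :: "real^2"
  proof -
    obtain e L where 1: "e > 0" "L > 0" "L-lipschitz_on (ball p e) f"
      using lipschitz_nearE[OF f] by blast
    have "(L * norm v)-lipschitz_on (ball p e) (\<lambda>x. f x *\<^sub>R v)"
    proof (rule lipschitz_onI)
      fix x y assume xy: "x \<in> ball p e" "y \<in> ball p e"
      have "dist (f x *\<^sub>R v) (f y *\<^sub>R v) = dist (f x) (f y) * norm v"
        by (simp add: dist_norm flip: scaleR_left_diff_distrib)
      also have "\<dots> \<le> L * dist x y * norm v"
        using lipschitz_onD[OF 1(3) xy] by (intro mult_right_mono) auto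
      finally show "dist (f x *\<^sub>R v) (f y *\<^sub>R v) \<le> L * norm v * dist x y"
        by (simp add: ac_simps)
    qed (use 1 in auto)
    with 1(1) show ?thesis by (auto simp: lipschitz_near_def)
  qed
  show ?thesis
    unfolding vector_2_eq by (rule lipschitz_near_add[OF sm[OF assms(1)] sm[OF assms(2)]])
qed

text \<open>Two points at distance less than 1 either both avoid \<open>K\<close>, where
  \<open>f\<close> vanishes, or both lie in a ball one unit larger than one containing
  \<open>K\<close>; on that bounded part of \<open>S\<close> compactness applies.\<close>

lemma uniformly_continuous_on_compact_support:
  fixes f :: "'a::heine_borel \<Rightarrow> 'b::real_normed_vector"
  assumes f: "continuous_on S f" and S: "closed S"
    and K: "compact K" "\<And>x. x \<in> S \<Longrightarrow> x \<notin> K \<Longrightarrow> f x = 0"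
  shows "uniformly_continuous_on S f"
proof (cases "K = {}")
  case True
  then show ?thesis
    using K(2) by (auto simp: uniformly_continuous_on_def intro: exI[of _ 1])
next
  case False
  then obtain a where a: "a \<in> K" by blast
  obtain r where "r > 0" "K \<subseteq> ball a r"
    using bounded_subset_ballD[OF compact_imp_bounded[OF K(1)]] by metis
  then have r: "r > 0" "\<And>x. x \<in> K \<Longrightarrow> dist a x \<le> r"
    by (auto intro: less_imp_le)
  have "compact (S \<inter> cball a (r + 1))"
    using S by (simp add: closed_Int_compact)
  then have "uniformly_continuous_on (S \<inter> cball a (r + 1)) f"
    by (intro compact_uniformly_continuous continuous_on_subset[OF f]) auto
  show ?thesis
    unfolding uniformly_continuous_on_def
  proof (intro allI impI)
    fix e :: real assume "e > 0"
    then obtain d where d: "d > 0" "\<And>x x'. x \<in> S \<inter> cball a (r + 1) \<Longrightarrow> x' \<in> S \<inter> cball a (r + 1) \<Longrightarrow>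
        dist x' x < d \<Longrightarrow> dist (f x') (f x) < e"
      using \<open>uniformly_continuous_on (S \<inter> cball a (r + 1)) f\<close>
      unfolding uniformly_continuous_on_def by meson
    have "dist (f x') (f x) < e" if x: "x \<in> S" "x' \<in> S" "dist x' x < min d 1" for x x'
    proof (cases "x \<in> K \<or> x' \<in> K")
      case True
      have "dist a x \<le> dist a x' + dist x' x" "dist a x' \<le> dist a x + dist x' x"
        by (metis dist_triangle, metis dist_triangle dist_commute)
      with True r(2) x(3) have "dist a x \<le> r + 1" "dist a x' \<le> r + 1"
        by (auto dest!: r(2))
      with x d(2) show ?thesis by simp
    next
      case False
      with K(2) x \<open>e > 0\<close> show ?thesis by simp
    qed
    with d(1) show "\<exists>d>0. \<forall>x\<in>S. \<forall>x'\<in>S. dist x' x < d \<longrightarrow> dist (f x') (f x) < e"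
      by (intro exI[of _ "min d 1"]) auto
  qed
qed

subsection \<open>Hausdorff dimension of planar sets\<close>

text \<open>A mass distribution principle. Points of \<open>S\<close> that \<open>f\<close> sends
  into one covering set of diameter d are within D d^\<alpha> of each other, hence lie in a cube of
  volume \<open>k\<close> d^s, where s is the dimension of the domain times \<alpha>. These cubes
  cover \<open>S\<close>, so the sum of the d^s is at least the volume of \<open>S\<close> divided
  by \<open>k\<close>.\<close>

lemma hausdorff_measure_pos_if_inverse_Hoelder:
  fixes f :: "'a::euclidean_space \<Rightarrow> 'b::metric_space"
  assumes S: "S \<in> sets lborel" "emeasure lborel S > 0"
    and f: "\<And>x y. x \<in> S \<Longrightarrow> y \<in> S \<Longrightarrow> dist x y \<le> C * dist (f x) (f y) powr \<alpha>"
    and \<alpha>: "\<alpha> > 0" and A: "f ` S \<subseteq> A"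
  shows "hausdorff_measure (real DIM('a) * \<alpha>) A > 0"
proof -
  \<comment> \<open>The maximum makes the constant positive whatever the sign of
    \<open>C\<close>.\<close>
  define D where "D = max C 1"
  define s where "s = real DIM('a) * \<alpha>"
  define k where "k = (2 * D) ^ DIM('a)"
  have D: "D > 0" and k: "k > 0" by (auto simp: D_def k_def)
  have fD: "dist x y \<le> D * dist (f x) (f y) powr \<alpha>" if "x \<in> S" "y \<in> S" for x y
    using f[OF that] by (rule order_trans) (auto intro!: mult_right_mono simp: D_def)
  define m where "m = ennreal (1 / k) * emeasure lborel S"
  have "m > 0" using S(2) k by (simp add: m_def ennreal_zero_less_mult_iff)
  have "m \<le> (\<Sum>i. ennreal (diameter (E i) powr s))"
    if E: "A \<subseteq> (\<Union>i. E i)" "\<And>i. bounded (E i)" for E :: "nat \<Rightarrow> 'b set"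
  proof -
    have "\<exists>p. \<forall>x\<in>S. f x \<in> E i \<longrightarrow> x \<in> cbox (p - (D * diameter (E i) powr \<alpha>) *\<^sub>R One) (p + (D * diameter (E i) powr \<alpha>) *\<^sub>R One)" for i
    proof (cases "\<exists>p\<in>S. f p \<in> E i")
      case True
      then obtain p where p: "p \<in> S" "f p \<in> E i" by blast
      have "x \<in> cbox (p - (D * diameter (E i) powr \<alpha>) *\<^sub>R One) (p + (D * diameter (E i) powr \<alpha>) *\<^sub>R One)"
        if x: "x \<in> S" "f x \<in> E i" for x
      proof -
        have "dist x p \<le> D * dist (f x) (f p) powr \<alpha>" using fD x p by blast
        also have "\<dots> \<le> D * diameter (E i) powr \<alpha>"
          using D \<alpha> diameter_bounded_bound[OF E(2) x(2) p(2)] by (intro mult_left_mono powr_mono2) auto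
        finally have le: "dist x p \<le> D * diameter (E i) powr \<alpha>" .
        have "\<bar>(x - p) \<bullet> b\<bar> \<le> D * diameter (E i) powr \<alpha>" if "b \<in> Basis" for b
          using le Basis_le_norm[OF that, of "x - p"] by (simp add: dist_norm)
        then show ?thesis
          by (fastforce simp: mem_box inner_diff_left inner_add_left abs_le_iff)
      qed
      then show ?thesis by blast
    qed auto
    then obtain p where p: "\<And>i x. x \<in> S \<Longrightarrow> f x \<in> E i \<Longrightarrow>
        x \<in> cbox (p i - (D * diameter (E i) powr \<alpha>) *\<^sub>R One) (p i + (D * diameter (E i) powr \<alpha>) *\<^sub>R One)"
      by metis
    define Q where "Q i = cbox (p i - (D * diameter (E i) powr \<alpha>) *\<^sub>R One) (p i + (D * diameter (E i) powr \<alpha>) *\<^sub>R One)" for i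
    have Q: "emeasure lborel (Q i) = ennreal k * ennreal (diameter (E i) powr s)" for i
    proof -
      have "emeasure lborel (Q i) = ennreal (\<Prod>b\<in>(Basis::'a set). 2 * (D * diameter (E i) powr \<alpha>))"
        unfolding Q_def using D
        by (subst emeasure_lborel_cbox) (auto simp: inner_diff_left inner_add_left intro!: arg_cong[where f = ennreal] prod.cong)
      also have "(\<Prod>b\<in>(Basis::'a set). 2 * (D * diameter (E i) powr \<alpha>)) = k * (diameter (E i) powr \<alpha>) ^ DIM('a)"
        by (simp add: k_def power_mult_distrib)
      also have "(diameter (E i) powr \<alpha>) ^ DIM('a) = diameter (E i) powr s"
        using diameter_ge_0[OF E(2)[of i]]
        by (cases "diameter (E i) = 0") (simp_all add: s_def powr_powr mult.commute flip: powr_realpow)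
      finally show ?thesis using k by (simp add: ennreal_mult)
    qed
    have "S \<subseteq> (\<Union>i. Q i)"
      using A E(1) p unfolding Q_def by blast
    then have "emeasure lborel S \<le> emeasure lborel (\<Union>i. Q i)"
      by (intro emeasure_mono) (auto simp: Q_def)
    also have "\<dots> \<le> (\<Sum>i. emeasure lborel (Q i))"
      by (intro emeasure_subadditive_countably) (auto simp: Q_def)
    also have "\<dots> = ennreal k * (\<Sum>i. ennreal (diameter (E i) powr s))"
      by (simp add: Q)
    finally have "m \<le> ennreal (1 / k) * (ennreal k * (\<Sum>i. ennreal (diameter (E i) powr s)))"
      unfolding m_def by (rule mult_left_mono) simp
    also have "\<dots> = (\<Sum>i. ennreal (diameter (E i) powr s))"
      using k by (simp add: mult.assoc[symmetric] ennreal_mult'[symmetric])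
    finally show ?thesis .
  qed
  \<comment> \<open>The estimate holds for covers of any mesh, so one scale is enough for a lower
    bound of the supremum; 1 is an arbitrary choice.\<close>
  then have "m \<le> hausdorff_pre s 1 A"
    unfolding hausdorff_pre_def by (intro INF_greatest) auto
  also have "\<dots> \<le> hausdorff_measure s A"
    unfolding hausdorff_measure_def by (intro SUP_upper) auto
  finally show ?thesis using \<open>m > 0\<close> by (simp add: s_def)
qed

text \<open>A grid of N^2 cells of side d / N has diameter sum at most N^2 (2 d / N)^s, which tends
  to 0 for s > 2.\<close>

lemma hausdorff_measure_planar_square_eq_0:
  fixes A :: "(real^2) set"
  assumes A: "A \<subseteq> {x. \<forall>i. 0 \<le> x $ i \<and> x $ i < c}" and s: "s > 2"
  shows "hausdorff_measure s A = 0"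
proof -
  define d where "d = max c 1"
  have d: "d > 0" "c \<le> d" by (auto simp: d_def)
  have "hausdorff_pre s \<delta> A = 0" if \<delta>: "\<delta> > 0" for \<delta>
  proof -
    define h where "h n = d / real (Suc n)" for n
    \<comment> \<open>One index \<open>i\<close> codes a cell by row \<open>i div Suc n\<close> and
      column \<open>i mod Suc n\<close>. Beyond the grid the sets are empty; their diameter 0
      contributes nothing to the sum.\<close>
    define E where "E n i = (if i < Suc n * Suc n then
        {x::real^2. real (i div Suc n) * h n \<le> x $ 1 \<and> x $ 1 \<le> (real (i div Suc n) + 1) * h n \<and>
           real (i mod Suc n) * h n \<le> x $ 2 \<and> x $ 2 \<le> (real (i mod Suc n) + 1) * h n} else {})" for n i
    have h: "h n > 0" for n using d by (simp add: h_def)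
    have dist_le: "dist x y \<le> 2 * h n" if "x \<in> E n i" "y \<in> E n i" for x y n i
    proof -
      have "\<bar>x $ 1 - y $ 1\<bar> \<le> h n" "\<bar>x $ 2 - y $ 2\<bar> \<le> h n"
        using that by (auto simp: E_def algebra_simps split: if_splits)
      moreover have "dist x y \<le> \<bar>x $ 1 - y $ 1\<bar> + \<bar>x $ 2 - y $ 2\<bar>"
        using norm_le_l1_cart[of "x - y"] by (simp add: dist_norm sum_2)
      ultimately show ?thesis by simp
    qed
    have bd: "bounded (E n i)" for n i
      using dist_le unfolding bounded_def by blast
    have dm: "diameter (E n i) \<le> 2 * h n" for n i
      using dist_le h[of n] by (intro diameter_le) (auto simp: dist_norm)
    have cov: "A \<subseteq> (\<Union>i. E n i)" for n
    proof
      fix x assume x: "x \<in> A"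
      have fl: "\<exists>k<Suc n. real k * h n \<le> y \<and> y \<le> (real k + 1) * h n" if y: "0 \<le> y" "y < c" for y
      proof -
        define k where "k = nat \<lfloor>y / h n\<rfloor>"
        have k: "real k = of_int \<lfloor>y / h n\<rfloor>" using y h[of n] by (simp add: k_def)
        have 1: "real k \<le> y / h n" "y / h n < real k + 1" unfolding k by linarith+
        have "y / h n = y / d * real (Suc n)" using d by (simp add: h_def)
        also have "\<dots> < 1 * real (Suc n)" using y d by (intro mult_strict_right_mono) auto
        finally have "y / h n < real (Suc n)" by simp
        with 1 have "k < Suc n" by linarith
        with 1 h[of n] show ?thesis by (intro exI[of _ k]) (auto simp: field_simps)
      qed
      have xb: "0 \<le> x $ 1" "x $ 1 < c" "0 \<le> x $ 2" "x $ 2 < c"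
        using A x by auto
      obtain k l where kl: "k < Suc n" "real k * h n \<le> x $ 1" "x $ 1 \<le> (real k + 1) * h n"
        "l < Suc n" "real l * h n \<le> x $ 2" "x $ 2 \<le> (real l + 1) * h n"
        using fl[OF xb(1,2)] fl[OF xb(3,4)] by blast
      define i where "i = k * Suc n + l"
      have i: "i div Suc n = k" "i mod Suc n = l" using kl(4) unfolding i_def by (simp_all del: mult_Suc_right)
      have "i < Suc n * Suc n"
        using kl(1,4) i div_less_iff_less_mult[of "Suc n" i "Suc n"] by simp
      then have "x \<in> E n i" using kl i by (simp add: E_def)
      then show "x \<in> (\<Union>i. E n i)" by blast
    qed
    have lim: "(\<lambda>n. (2 * d) powr s * real (Suc n) powr (2 - s)) \<longlonglongrightarrow> (2 * d) powr s * 0"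
    proof (intro tendsto_mult tendsto_const)
      have "(\<lambda>n. real n powr (2 - s)) \<longlonglongrightarrow> 0"
        using s by (intro tendsto_neg_powr) (auto simp: filterlim_real_sequentially)
      then show "(\<lambda>n. real (Suc n) powr (2 - s)) \<longlonglongrightarrow> 0"
        by (rule LIMSEQ_Suc)
    qed
    have "(\<lambda>n. 2 * d * (1 / real (Suc n))) \<longlonglongrightarrow> 2 * d * 0"
      using LIMSEQ_inverse_real_of_nat by (intro tendsto_mult tendsto_const) (simp add: inverse_eq_divide)
    then have "\<forall>\<^sub>F n in sequentially. 2 * h n < \<delta>"
      using \<delta> by (simp add: h_def order_tendsto_iff)
    then have ev: "\<forall>\<^sub>F n in sequentially. hausdorff_pre s \<delta> A \<le> ennreal ((2 * d) powr s * real (Suc n) powr (2 - s))"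
    proof eventually_elim
      case (elim n)
      have "hausdorff_pre s \<delta> A \<le> (\<Sum>i. ennreal (diameter (E n i) powr s))"
        unfolding hausdorff_pre_def
        by (rule INF_lower) (use cov bd order_trans[OF dm less_imp_le[OF elim]] in auto)
      also have "\<dots> = (\<Sum>i<Suc n * Suc n. ennreal (diameter (E n i) powr s))"
        using s by (intro suminf_finite) (auto simp: E_def)
      also have "\<dots> \<le> (\<Sum>i<Suc n * Suc n. ennreal ((2 * h n) powr s))"
        using dm s by (intro sum_mono ennreal_leI powr_mono2) (auto simp: diameter_ge_0 bd)
      also have "\<dots> = ennreal (real (Suc n * Suc n) * (2 * h n) powr s)"
        unfolding sum_constant card_lessThan by (subst ennreal_mult) (simp_all del: of_nat_mult of_nat_Suc mult_Suc add: ennreal_of_nat_eq_real_of_nat)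
      also have "real (Suc n * Suc n) * (2 * h n) powr s = (2 * d) powr s * real (Suc n) powr (2 - s)"
      proof -
        have "(2 * h n) powr s = (2 * d) powr s / real (Suc n) powr s"
          using d by (simp add: h_def powr_divide)
        moreover have "real (Suc n * Suc n) = real (Suc n) powr 2"
          by (simp only: of_nat_mult) (simp add: powr_numeral power2_eq_square)
        ultimately show ?thesis by (simp add: powr_diff)
      qed
      finally show ?case .
    qed
    have "(\<lambda>n. ennreal ((2 * d) powr s * real (Suc n) powr (2 - s))) \<longlonglongrightarrow> ennreal 0"
      using lim by (intro tendsto_ennrealI) simp
    then have "hausdorff_pre s \<delta> A \<le> ennreal 0"
      using ev by (rule tendsto_lowerbound) simp
    then show ?thesis by simp
  qed
  then show ?thesis by (simp add: hausdorff_measure_def)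
qed

text \<open>\<open>hausdorff_dim\<close> is the infimum of the exponents of measure zero, so
  positivity excludes the exponents below 2 one by one. Nothing is asked at 2 itself, as suits a set
  of area zero.\<close>

lemma hausdorff_dim_planar_eq_2:
  fixes A :: "(real^2) set"
  assumes "A \<subseteq> {x. \<forall>i. 0 \<le> x $ i \<and> x $ i < c}"
    and pos: "\<And>s. 0 < s \<Longrightarrow> s < 2 \<Longrightarrow> hausdorff_measure s A > 0"
  shows "hausdorff_dim A = 2"
proof (rule antisym)
  have "hausdorff_dim A \<le> ereal s" if "s > 2" for s
    unfolding hausdorff_dim_def
    using that hausdorff_measure_planar_square_eq_0[OF assms(1) that] by (intro Inf_lower) auto
  from this[of "2 + e" for e] have "hausdorff_dim A \<le> 2 + ereal e" if "e > 0" for e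
    using that by simp
  then show "hausdorff_dim A \<le> 2"
    by (rule ereal_le_epsilon2[rule_format])
  show "2 \<le> hausdorff_dim A"
    unfolding hausdorff_dim_def
  proof (rule Inf_greatest, safe)
    fix s :: real assume "0 < s" "hausdorff_measure s A = 0"
    with pos[of s] show "2 \<le> ereal s" by (cases "s < 2") auto
  qed
qed

subsection \<open>A Cantor set growing out of a point\<close>

text \<open>The C^1 step from 0 to 1 made of two parabolas, with second derivative 4 on the first
  half of the unit interval and -4 on the second. Written with truncated powers it can be
  differentiated, and its derivative estimated, term by term. It serves for the growth of a gap in
  time, the velocity across a gap and the cutoffs.\<close>

definition sstep :: "real \<Rightarrow> real" where
  "sstep y = 2 * (max 0 y)\<^sup>2 - 4 * (max 0 (y - 1/2))\<^sup>2 + 2 * (max 0 (y - 1))\<^sup>2"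

definition dsstep :: "real \<Rightarrow> real" where
  "dsstep y = 4 * max 0 y - 8 * max 0 (y - 1/2) + 4 * max 0 (y - 1)"

lemma sstep_cases:
  "y \<le> 0 \<Longrightarrow> sstep y = 0"
  "0 \<le> y \<Longrightarrow> y \<le> 1/2 \<Longrightarrow> sstep y = 2 * y\<^sup>2"
  "1/2 \<le> y \<Longrightarrow> y \<le> 1 \<Longrightarrow> sstep y = 1 - 2 * (1 - y)\<^sup>2"
  "1 \<le> y \<Longrightarrow> sstep y = 1"
  by (simp_all add: sstep_def max_def power2_eq_square algebra_simps split: if_splits)

lemma dsstep_cases:
  "y \<le> 0 \<Longrightarrow> dsstep y = 0"
  "0 \<le> y \<Longrightarrow> y \<le> 1/2 \<Longrightarrow> dsstep y = 4 * y"
  "1/2 \<le> y \<Longrightarrow> y \<le> 1 \<Longrightarrow> dsstep y = 4 * (1 - y)"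
  "1 \<le> y \<Longrightarrow> dsstep y = 0"
  by (simp_all add: dsstep_def max_def algebra_simps split: if_splits)

lemma unit_interval_cases:
  fixes y :: real
  obtains "y \<le> 0" | "0 \<le> y" "y \<le> 1/2" | "1/2 \<le> y" "y \<le> 1" | "1 \<le> y"
  by linarith

lemma dsstep_nonneg: "dsstep y \<ge> 0"
  by (rule unit_interval_cases[of y]) (simp_all add: dsstep_cases)

lemma dsstep_le_2: "dsstep y \<le> 2"
  by (rule unit_interval_cases[of y]) (simp_all add: dsstep_cases)

lemma sstep_nonneg: "sstep y \<ge> 0"
proof (rule unit_interval_cases[of y])
  assume y: "1/2 \<le> y" "y \<le> 1"
  have "(1 - y)\<^sup>2 \<le> (1/2)\<^sup>2" using y by (intro power_mono) auto
  with y show ?thesis by (simp add: sstep_cases power2_eq_square)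
qed (simp_all add: sstep_cases)

lemma sstep_pos: "y > 0 \<Longrightarrow> sstep y > 0"
proof (rule unit_interval_cases[of y])
  assume y: "1/2 \<le> y" "y \<le> 1"
  have "(1 - y)\<^sup>2 \<le> (1/2)\<^sup>2" using y by (intro power_mono) auto
  with y show ?thesis by (simp add: sstep_cases power2_eq_square)
qed (simp_all add: sstep_cases)

lemma sstep_le_1: "sstep y \<le> 1"
proof (rule unit_interval_cases[of y])
  assume y: "0 \<le> y" "y \<le> 1/2"
  have "y\<^sup>2 \<le> (1/2)\<^sup>2" using y by (intro power_mono) auto
  with y show ?thesis by (simp add: sstep_cases power2_eq_square)
qed (simp_all add: sstep_cases)

lemma sstep_le_square: "sstep y \<le> 2 * y\<^sup>2"
proof (rule unit_interval_cases[of y])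
  assume y: "1/2 \<le> y" "y \<le> 1"
  \<comment> \<open>On this piece the difference of the two sides is exactly this square.\<close>
  have "0 \<le> (2 * y - 1)\<^sup>2" by simp
  with y show ?thesis by (simp add: sstep_cases power2_eq_square algebra_simps)
next
  assume "1 \<le> y"
  then have "1\<^sup>2 \<le> y\<^sup>2" by (intro power_mono) auto
  then have "1 \<le> y\<^sup>2" by simp
  with \<open>1 \<le> y\<close> show ?thesis by (simp add: sstep_cases del: one_le_power)
qed (simp_all add: sstep_cases)

text \<open>For positive y the logarithmic derivative is at most 2 / y, the value for the pure
  square; on the upper half of the unit interval the sides differ by 4 y - 2. This is the source of
  the rate 2 / t of the gaps.\<close>

lemma mult_dsstep_le: "y * dsstep y \<le> 2 * sstep y"
proof (rule unit_interval_cases[of y])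
  assume "1/2 \<le> y" "y \<le> 1"
  then show ?thesis by (simp add: sstep_cases dsstep_cases power2_eq_square algebra_simps)
qed (simp_all add: sstep_cases dsstep_cases power2_eq_square)

lemma has_real_derivative_max_0_square:
  "((\<lambda>y. (max 0 y)\<^sup>2) has_real_derivative 2 * max 0 y) (at (y::real))"
proof (cases y "0::real" rule: linorder_cases)
  case less
  have "((\<lambda>y. 0) has_real_derivative 0) (at y)" by simp
  then have "((\<lambda>y. (max 0 y)\<^sup>2) has_real_derivative 0) (at y)"
    by (rule has_field_derivative_transform_within_open[where S = "{..<0}"]) (use less in auto)
  with less show ?thesis by simp
next
  case greater
  have "((\<lambda>y. y\<^sup>2) has_real_derivative 2 * y) (at y)" by (auto intro!: derivative_eq_intros)
  then have "((\<lambda>y. (max 0 y)\<^sup>2) has_real_derivative 2 * y) (at y)"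
    by (rule has_field_derivative_transform_within_open[where S = "{0<..}"]) (use greater in auto)
  with greater show ?thesis by simp
next
  case equal
  have "((\<lambda>h::real. (max 0 h)\<^sup>2 / h) \<longlongrightarrow> 0) (at 0)"
  proof (rule Lim_null_comparison)
    show "\<forall>\<^sub>F h in at 0. norm ((max 0 h)\<^sup>2 / h) \<le> \<bar>h::real\<bar>"
      by (auto simp: max_def power2_eq_square)
    show "((\<lambda>h::real. \<bar>h\<bar>) \<longlongrightarrow> 0) (at 0)"
      using tendsto_rabs[OF tendsto_ident_at, of "0::real" UNIV] by simp
  qed
  then show ?thesis using equal by (simp add: has_field_derivative_iff)
qed

lemma sstep_has_real_derivative: "(sstep has_real_derivative dsstep y) (at y)"
proof -
  have 1: "((\<lambda>y. (max 0 (y - c))\<^sup>2) has_real_derivative 2 * max 0 (y - c)) (at y)" for c :: real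
    using DERIV_chain2[OF has_real_derivative_max_0_square, of "\<lambda>y. y - c" 1 y UNIV] DERIV_diff[OF DERIV_ident DERIV_const[of c], of y UNIV]
    by simp
  have "((\<lambda>y. 2 * (max 0 y)\<^sup>2 - 4 * (max 0 (y - 1/2))\<^sup>2 + 2 * (max 0 (y - 1))\<^sup>2) has_real_derivative
      2 * (2 * max 0 y) - 4 * (2 * max 0 (y - 1/2)) + 2 * (2 * max 0 (y - 1))) (at y)"
    by (intro DERIV_add DERIV_diff DERIV_cmult 1 has_real_derivative_max_0_square)
  moreover have "sstep = (\<lambda>y. 2 * (max 0 y)\<^sup>2 - 4 * (max 0 (y - 1/2))\<^sup>2 + 2 * (max 0 (y - 1))\<^sup>2)"
    by (simp add: fun_eq_iff sstep_def)
  ultimately show ?thesis by (simp add: dsstep_def)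
qed

lemma sstep_lipschitz: "2-lipschitz_on UNIV sstep"
proof (rule lipschitz_onI)
  have le: "\<bar>sstep y - sstep x\<bar> \<le> 2 * \<bar>y - x\<bar>" if xy: "x < y" for x y
  proof -
    obtain z where "sstep y - sstep x = (y - x) * dsstep z"
      using MVT2[OF xy, of sstep dsstep] sstep_has_real_derivative by blast
    then show ?thesis
      using mult_left_mono[OF dsstep_le_2[of z], of "y - x"] dsstep_nonneg[of z] xy
      by (simp add: abs_mult mult.commute)
  qed
  show "dist (sstep x) (sstep y) \<le> 2 * dist x y" for x y
    using le[of x y] le[of y x] by (cases x y rule: linorder_cases) (auto simp: dist_real_def abs_minus_commute)
qed simp

text \<open>The constant is the sum 4 + 8 + 4 of the coefficients of the truncated terms, each of
  which is Lipschitz with constant 1 before scaling.\<close>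

lemma dsstep_lipschitz: "16-lipschitz_on UNIV dsstep"
proof (rule lipschitz_onI)
  fix x y :: real
  have m: "\<bar>a * (max 0 (x - c) - max 0 (y - c))\<bar> \<le> a * \<bar>x - y\<bar>" if "a \<ge> 0" for a c
    using that by (simp add: abs_mult max_def mult_left_mono)
  show "dist (dsstep x) (dsstep y) \<le> 16 * dist x y"
  proof -
    have "dsstep x - dsstep y = 4 * (max 0 (x - 0) - max 0 (y - 0))
        - 8 * (max 0 (x - 1/2) - max 0 (y - 1/2)) + 4 * (max 0 (x - 1) - max 0 (y - 1))"
      by (simp add: dsstep_def)
    also have "\<bar>\<dots>\<bar> \<le> 4 * \<bar>x - y\<bar> + 8 * \<bar>x - y\<bar> + 4 * \<bar>x - y\<bar>"
      by (intro abs_triangle_ineq[THEN order_trans] abs_triangle_ineq4[THEN order_trans] add_mono m) simp_all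
    finally show ?thesis by (simp add: dist_real_def)
  qed
qed simp

text \<open>The \<open>2 ^ j\<close> gaps of generation \<open>j\<close> have length \<open>2 ^ (-j)\<close> up to a polynomial factor, which is
  what makes the Cantor set one-dimensional in spite of its zero length. They all open at time \<open>0\<close>, with
  logarithmic growth rate at most \<open>2 / t\<close>, and stand still once \<open>(j + 1) t \<ge> 1\<close>: at any positive time only
  finitely many gaps move.\<close>

definition gap :: "nat \<Rightarrow> real \<Rightarrow> real" where
  "gap j t = sstep (real (j + 1) * t) / (2 ^ j * real (j + 1) ^ 4)"

definition dgap :: "nat \<Rightarrow> real \<Rightarrow> real" where
  "dgap j t = real (j + 1) * dsstep (real (j + 1) * t) / (2 ^ j * real (j + 1) ^ 4)"

lemma gap_nonneg: "gap j t \<ge> 0"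
  by (simp add: gap_def sstep_nonneg)

lemma gap_pos: "t > 0 \<Longrightarrow> gap j t > 0"
  by (simp add: gap_def sstep_pos)

lemma dgap_nonneg: "dgap j t \<ge> 0"
  by (simp add: dgap_def dsstep_nonneg)

lemma gap_0 [simp]: "gap j 0 = 0"
  by (simp add: gap_def sstep_cases)

lemma gap_frozen: "real (j + 1) * t \<ge> 1 \<Longrightarrow> gap j t = 1 / (2 ^ j * real (j + 1) ^ 4)"
  by (simp add: gap_def sstep_cases)

lemma dgap_frozen: "real (j + 1) * t \<ge> 1 \<Longrightarrow> dgap j t = 0"
  by (simp add: dgap_def dsstep_cases)

lemma gap_has_real_derivative: "(gap j has_real_derivative dgap j t) (at t)"
proof -
  have "((\<lambda>t. sstep (real (j + 1) * t)) has_real_derivative dsstep (real (j + 1) * t) * real (j + 1)) (at t)"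
    by (rule DERIV_chain2[OF sstep_has_real_derivative]) (auto intro!: derivative_eq_intros)
  from DERIV_cdivide[OF this, of "2 ^ j * real (j + 1) ^ 4"] show ?thesis
    unfolding gap_def[abs_def] dgap_def by (simp add: mult.commute)
qed

lemma dgap_le: "t > 0 \<Longrightarrow> dgap j t \<le> 2 / t * gap j t"
proof -
  assume t: "t > 0"
  have "t * (real (j + 1) * dsstep (real (j + 1) * t)) \<le> 2 * sstep (real (j + 1) * t)"
    using mult_dsstep_le[of "real (j + 1) * t"] by (simp add: mult_ac)
  then have "real (j + 1) * dsstep (real (j + 1) * t) \<le> 2 / t * sstep (real (j + 1) * t)"
    using t by (simp add: field_simps)
  then show ?thesis
    unfolding gap_def dgap_def times_divide_eq_right by (rule divide_right_mono) simp
qed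

section \<open>Total length of the gaps\<close>

lemma inverse_square_summable: "summable (\<lambda>j. 1 / (real (j + 1))\<^sup>2)"
  using inverse_squares_sums by (auto simp: sums_iff add.commute)

definition width_const :: real where
  "width_const = (\<Sum>j. 1 / (real (j + 1))\<^sup>2)"

lemma width_const_pos: "width_const > 0"
  unfolding width_const_def by (rule suminf_pos[OF inverse_square_summable]) simp

text \<open>The left side is the total length of generation \<open>j\<close>. The quadratic bound on
  \<open>sstep\<close> uses up two of the four powers of j + 1 in the denominator, and the other two
  make the series over \<open>j\<close> converge.\<close>

lemma gap_scaled_le_square: "2 ^ j * gap j t \<le> 2 * t\<^sup>2 * (1 / (real (j + 1))\<^sup>2)"
proof -
  have "2 ^ j * gap j t = sstep (real (j + 1) * t) / real (j + 1) ^ 4"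
    by (simp add: gap_def)
  also have "\<dots> \<le> 2 * (real (j + 1) * t)\<^sup>2 / real (j + 1) ^ 4"
    by (intro divide_right_mono sstep_le_square) auto
  also have "\<dots> = 2 * t\<^sup>2 * (1 / (real (j + 1))\<^sup>2)"
  proof -
    have "real (j + 1) ^ 4 = (real (j + 1))\<^sup>2 * (real (j + 1))\<^sup>2" by (simp flip: power_add)
    then show ?thesis
      by (simp only: power_mult_distrib) (simp add: field_simps del: of_nat_add of_nat_Suc)
  qed
  finally show ?thesis .
qed

lemma gap_scaled_lipschitz: "2 ^ j * \<bar>gap j s - gap j t\<bar> \<le> 2 * \<bar>s - t\<bar> * (1 / (real (j + 1))\<^sup>2)"
proof -
  have "2 ^ j * \<bar>gap j s - gap j t\<bar> = \<bar>sstep (real (j + 1) * s) - sstep (real (j + 1) * t)\<bar> / real (j + 1) ^ 4"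
    by (simp add: gap_def abs_divide flip: diff_divide_distrib)
  also have "\<dots> \<le> 2 * (real (j + 1) * \<bar>s - t\<bar>) / real (j + 1) ^ 4"
    using lipschitz_onD[OF sstep_lipschitz, of "real (j + 1) * s" "real (j + 1) * t"]
    by (intro divide_right_mono) (auto simp: dist_real_def abs_mult simp flip: right_diff_distrib)
  also have "\<dots> \<le> 2 * \<bar>s - t\<bar> * (1 / (real (j + 1))\<^sup>2)"
  proof -
    \<comment> \<open>The exponent 3 is lowered to 2 so that the series defining
      \<open>width_const\<close> serves here as well.\<close>
    have "real (j + 1) / real (j + 1) ^ 4 = 1 / real (j + 1) ^ 3"
      by (simp add: power_numeral_reduce)
    also have "\<dots> \<le> 1 / (real (j + 1))\<^sup>2"
      by (intro divide_left_mono power_increasing) auto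
    finally have "real (j + 1) / real (j + 1) ^ 4 \<le> 1 / (real (j + 1))\<^sup>2" .
    from mult_left_mono[OF this, of "2 * \<bar>s - t\<bar>"] show ?thesis by (simp add: mult_ac)
  qed
  finally show ?thesis .
qed

text \<open>The midpoints of the dyadic intervals of length 2^(-j). With \<open>k < 2 ^ j\<close>
  every dyadic rational strictly between 0 and 1 occurs exactly once.\<close>

definition node :: "nat \<Rightarrow> nat \<Rightarrow> real" where
  "node j k = (2 * real k + 1) / 2 ^ (j + 1)"

text \<open>The numerators are odd: with two different generations, clearing denominators would
  equate an even and an odd number.\<close>

lemma node_inject: 
  assumes "node j k = node j' k'"
  shows "j = j' \<and> k = k'"
proof -
  have *: False if eq: "node j k = node j' k'" and "j < j'" for j j' k k'
  proof -
    obtain d where d: "j' = j + Suc d" using \<open>j < j'\<close> less_iff_Suc_add by auto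
    have "(2 * real k' + 1) / (2 ^ (j + 1) * 2 ^ Suc d) = (2 * real k + 1) / 2 ^ (j + 1)"
      using eq by (simp add: node_def d flip: power_add)
    moreover have "b * D = a" if "a / (A * D) = b / A" "A > 0" "D > 0" for a b A D :: real
      using that by (simp add: field_simps)
    ultimately have "(2 * real k + 1) * 2 ^ Suc d = 2 * real k' + 1"
      by (metis zero_less_numeral zero_less_power)
    then have "real ((2 * k + 1) * 2 ^ Suc d) = real (2 * k' + 1)" by (simp add: algebra_simps)
    then have "(2 * k + 1) * 2 ^ Suc d = 2 * k' + 1" by (simp only: of_nat_eq_iff)
    then have "even (2 * k' + 1)" by (metis dvd_mult dvd_power zero_less_Suc)
    then show False by simp
  qed
  have "j = j'" using *[of j k j' k'] *[of j' k' j k] assms by (metis linorder_neqE_nat)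
  with assms show ?thesis by (simp add: node_def)
qed

text \<open>The strict inequality makes this count continuous from the left, and with it
  \<open>trajectory\<close>; a label equal to a node belongs to the left end of the gap.\<close>

definition cnt :: "nat \<Rightarrow> real \<Rightarrow> real" where
  "cnt j \<theta> = (\<Sum>k<2^j. of_bool (node j k < \<theta>))"

lemma cnt_nonneg: "cnt j \<theta> \<ge> 0"
  by (simp add: cnt_def sum_nonneg)

lemma cnt_le: "cnt j \<theta> \<le> 2 ^ j"
  using sum_bounded_above[of "{..<2^j::nat}" "\<lambda>k. of_bool (node j k < \<theta>)" "1::real"] by (simp add: cnt_def)

lemma cnt_mono: "\<theta> \<le> \<theta>' \<Longrightarrow> cnt j \<theta> \<le> cnt j \<theta>'"
  unfolding cnt_def by (intro sum_mono) auto

lemma cnt_jump: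
  assumes "k < 2 ^ j" "\<theta> \<le> node j k" "node j k < \<theta>'"
  shows "cnt j \<theta> + 1 \<le> cnt j \<theta>'"
proof -
  have "cnt j \<theta>' - cnt j \<theta> = (\<Sum>i<2^j. of_bool (node j i < \<theta>') - of_bool (node j i < \<theta>))"
    by (simp add: cnt_def sum_subtractf)
  also have "\<dots> \<ge> (\<Sum>i\<in>{k}. of_bool (node j i < \<theta>') - of_bool (node j i < \<theta>))"
    by (rule sum_mono2) (use assms in auto)
  finally show ?thesis using assms by simp
qed

lemma node_between:
  assumes "0 \<le> \<theta>" "\<theta>' \<le> 1" "\<theta>' - \<theta> \<ge> 1 / 2 ^ j"
  obtains k where "k < 2 ^ j" "\<theta> \<le> node j k" "node j k < \<theta>'"
proof -
  \<comment> \<open>The least index with \<theta> at or below \<open>node j k\<close>, since 2^j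
    times that node is k + 1/2. The nodes of one generation are 2^(-j) apart, so this one has not
    yet reached \<theta>'.\<close>
  define k where "k = nat \<lceil>2 ^ j * \<theta> - 1 / 2\<rceil>"
  have "2 ^ j * \<theta> \<ge> 0" using assms by simp
  then have "\<lceil>2 ^ j * \<theta> - 1 / 2\<rceil> \<ge> 0" by linarith
  then have k: "real k = of_int \<lceil>2 ^ j * \<theta> - 1 / 2\<rceil>" by (simp add: k_def)
  have 1: "2 ^ j * \<theta> \<le> real k + 1 / 2" "real k + 1 / 2 < 2 ^ j * \<theta> + 1" unfolding k by linarith+
  have "2 ^ j * \<theta> + 1 \<le> 2 ^ j * \<theta>'" using assms(3) by (simp add: field_simps)
  with 1 have 2: "real k + 1 / 2 < 2 ^ j * \<theta>'" by linarith
  also have "2 ^ j * \<theta>' \<le> 2 ^ j * 1" using assms(2) by (intro mult_left_mono) auto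
  finally have "real k < real (2 ^ j)" by (simp del: of_nat_less_iff of_nat_less_numeral_power_cancel_iff)
  then have "k < 2 ^ j" by (simp only: of_nat_less_iff)
  moreover have "\<theta> \<le> node j k" "node j k < \<theta>'"
    using 1(1) 2 by (simp_all add: node_def field_simps)
  ultimately show thesis using that by blast
qed

text \<open>The particle with label \<open>\<theta>\<close> has every gap sitting at a dyadic \<open>node\<close> below \<open>\<theta>\<close> to its left.\<close>

definition trajectory :: "real \<Rightarrow> real \<Rightarrow> real" where
  "trajectory t \<theta> = (\<Sum>j. gap j t * cnt j \<theta>)"

lemma gap_cnt_le: "gap j t * cnt j \<theta> \<le> 2 * t\<^sup>2 * (1 / (real (j + 1))\<^sup>2)"
  using gap_scaled_le_square[of j t] mult_left_mono[OF cnt_le gap_nonneg, of j t j \<theta>]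
  by (simp add: mult.commute)

lemma gap_cnt_summable: "summable (\<lambda>j. gap j t * cnt j \<theta>)"
proof (rule summable_comparison_test')
  show "summable (\<lambda>j. 2 * t\<^sup>2 * (1 / (real (j + 1))\<^sup>2))"
    by (intro summable_mult inverse_square_summable)
  show "norm (gap j t * cnt j \<theta>) \<le> 2 * t\<^sup>2 * (1 / (real (j + 1))\<^sup>2)" if "j \<ge> 0" for j
    using gap_cnt_le[of j t \<theta>] by (simp add: gap_nonneg cnt_nonneg)
qed

section \<open>Estimates and regularity of the trajectories\<close>

lemma trajectory_nonneg: "trajectory t \<theta> \<ge> 0"
  unfolding trajectory_def by (intro suminf_nonneg gap_cnt_summable mult_nonneg_nonneg gap_nonneg cnt_nonneg)

lemma trajectory_le: "trajectory t \<theta> \<le> 2 * width_const * t\<^sup>2"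
proof -
  have "trajectory t \<theta> \<le> (\<Sum>j. 2 * t\<^sup>2 * (1 / (real (j + 1))\<^sup>2))"
    unfolding trajectory_def
    by (intro suminf_le gap_cnt_le gap_cnt_summable summable_mult inverse_square_summable)
  also have "\<dots> = 2 * t\<^sup>2 * width_const"
    unfolding width_const_def by (rule suminf_mult[OF inverse_square_summable])
  finally show ?thesis by (simp add: mult_ac)
qed

lemma trajectory_0 [simp]: "trajectory 0 \<theta> = 0"
  by (simp add: trajectory_def)

lemma trajectory_mono: "\<theta> \<le> \<theta>' \<Longrightarrow> trajectory t \<theta> \<le> trajectory t \<theta>'"
  unfolding trajectory_def by (intro suminf_le mult_left_mono cnt_mono gap_nonneg gap_cnt_summable)

text \<open>One summand grows by at least the gap, and all others are monotone in the label. This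
  one inequality places the particles outside the gaps, makes the gaps disjoint and yields the
  inverse Hoelder bound.\<close>

lemma trajectory_jump:
  assumes "k < 2 ^ j" "\<theta> \<le> node j k" "node j k < \<theta>'"
  shows "trajectory t \<theta> + gap j t \<le> trajectory t \<theta>'"
proof -
  have le: "\<theta> \<le> \<theta>'" using assms by simp
  have "gap j t * 1 \<le> gap j t * (cnt j \<theta>' - cnt j \<theta>)"
    using cnt_jump[OF assms] gap_nonneg[of j t] by (intro mult_left_mono) auto
  also have "\<dots> = (\<Sum>i\<in>{j}. gap i t * (cnt i \<theta>' - cnt i \<theta>))" by simp
  also have "\<dots> \<le> (\<Sum>i. gap i t * (cnt i \<theta>' - cnt i \<theta>))"
  proof (rule sum_le_suminf)
    show "summable (\<lambda>i. gap i t * (cnt i \<theta>' - cnt i \<theta>))"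
      using summable_diff[OF gap_cnt_summable gap_cnt_summable] by (simp add: right_diff_distrib)
  qed (use cnt_mono[OF le] gap_nonneg in auto)
  also have "\<dots> = trajectory t \<theta>' - trajectory t \<theta>"
    unfolding trajectory_def right_diff_distrib by (rule suminf_diff[OF gap_cnt_summable gap_cnt_summable, symmetric])
  finally show ?thesis by simp
qed

lemma trajectory_lipschitz: "(2 * width_const)-lipschitz_on UNIV (\<lambda>t. trajectory t \<theta>)"
proof (rule lipschitz_onI)
  fix s t :: real
  have b: "norm (gap j s * cnt j \<theta> - gap j t * cnt j \<theta>) \<le> 2 * \<bar>s - t\<bar> * (1 / (real (j + 1))\<^sup>2)" for j
  proof -
    have "norm (gap j s * cnt j \<theta> - gap j t * cnt j \<theta>) = cnt j \<theta> * \<bar>gap j s - gap j t\<bar>"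
      by (simp add: abs_mult cnt_nonneg flip: left_diff_distrib)
    also have "\<dots> \<le> 2 ^ j * \<bar>gap j s - gap j t\<bar>" by (intro mult_right_mono cnt_le) auto
    finally show ?thesis using gap_scaled_lipschitz[of j s t] by linarith
  qed
  have sm: "summable (\<lambda>j. 2 * \<bar>s - t\<bar> * (1 / (real (j + 1))\<^sup>2))"
    by (intro summable_mult inverse_square_summable)
  have "trajectory s \<theta> - trajectory t \<theta> = (\<Sum>j. gap j s * cnt j \<theta> - gap j t * cnt j \<theta>)"
    unfolding trajectory_def by (rule suminf_diff[OF gap_cnt_summable gap_cnt_summable])
  also have "norm \<dots> \<le> (\<Sum>j. 2 * \<bar>s - t\<bar> * (1 / (real (j + 1))\<^sup>2))"
    by (rule norm_suminf_le[OF b sm])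
  also have "\<dots> = 2 * \<bar>s - t\<bar> * width_const"
    unfolding width_const_def by (rule suminf_mult[OF inverse_square_summable])
  finally show "dist (trajectory s \<theta>) (trajectory t \<theta>) \<le> 2 * width_const * dist s t"
    by (simp add: dist_real_def mult_ac)
qed (use width_const_pos in simp)

lemma trajectory_has_real_derivative:
  assumes t: "t > 0" and n: "1 < real n * t"
  shows "((\<lambda>t. trajectory t \<theta>) has_real_derivative (\<Sum>j<n. dgap j t * cnt j \<theta>)) (at t)"
proof -
  \<comment> \<open>The contribution of the generations from \<open>n\<close> on. They are already
    frozen on a neighbourhood of \<open>t\<close>, so there the trajectory is a finite sum plus this
    constant.\<close>
  define c where "c = (\<Sum>j. 1 / (2 ^ (j + n) * real (j + n + 1) ^ 4) * cnt (j + n) \<theta>)"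
  have n0: "n > 0" using n t by (cases n) auto
  have eq: "(\<Sum>j<n. gap j s * cnt j \<theta>) + c = trajectory s \<theta>" if s: "s \<in> {1 / real n<..}" for s
  proof -
    have "gap (j + n) s = 1 / (2 ^ (j + n) * real (j + n + 1) ^ 4)" for j
    proof (rule gap_frozen)
      have "1 < real n * s" using s n0 by (simp add: field_simps)
      also have "\<dots> \<le> real (j + n + 1) * s"
        using s n0 less_trans[of 0 "1 / real n" s] by (intro mult_right_mono) auto
      finally show "1 \<le> real (j + n + 1) * s" by simp
    qed
    then show ?thesis
      unfolding trajectory_def c_def using suminf_split_initial_segment[OF gap_cnt_summable, of s \<theta> n] by simp
  qed
  have "((\<lambda>s. (\<Sum>j<n. gap j s * cnt j \<theta>) + c) has_real_derivative (\<Sum>j<n. dgap j t * cnt j \<theta>) + 0) (at t)"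
    by (intro DERIV_add DERIV_sum DERIV_cmult_right gap_has_real_derivative DERIV_const)
  then have "((\<lambda>t. trajectory t \<theta>) has_real_derivative (\<Sum>j<n. dgap j t * cnt j \<theta>) + 0) (at t)"
    by (rule has_field_derivative_transform_within_open[where S = "{1 / real n<..}", OF _ _ _ eq])
       (use n n0 in \<open>auto simp: field_simps\<close>)
  then show ?thesis by simp
qed

subsection \<open>The velocity field\<close>

text \<open>Generations with index at least \<open>active t\<close> have stopped. At
  \<open>t = 0\<close> the convention 1 / 0 = 0 makes the sums over active generations empty, so
  \<open>vel 0\<close> vanishes.\<close>

definition active :: "real \<Rightarrow> nat" where
  "active t = nat \<lceil>1 / t\<rceil>"

text \<open>Inside a gap the velocity increases by the opening rate of that gap, with zero slope at both ends.
  So the slope vanishes on the Cantor set.\<close>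

definition vel :: "real \<Rightarrow> real \<Rightarrow> real" where
  "vel t x = (\<Sum>j<active t. \<Sum>k<2^j. dgap j t * sstep ((x - trajectory t (node j k)) / gap j t))"

definition dvel :: "real \<Rightarrow> real \<Rightarrow> real" where
  "dvel t x = (\<Sum>j<active t. \<Sum>k<2^j. dgap j t / gap j t * dsstep ((x - trajectory t (node j k)) / gap j t))"

text \<open>The constant value of \<open>vel t\<close> to the right of all gaps.\<close>

definition total_rate :: "real \<Rightarrow> real" where
  "total_rate t = (\<Sum>j<active t. 2 ^ j * dgap j t)"

text \<open>The bound of \<open>trajectory_le\<close>: for positive times, all particles and all
  gaps lie between 0 and \<open>radius t\<close>.\<close>

definition radius :: "real \<Rightarrow> real" where
  "radius t = 2 * width_const * t\<^sup>2"

lemma radius_pos: "t > 0 \<Longrightarrow> radius t > 0"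
  by (simp add: radius_def width_const_pos)

lemma active_mult_ge_1: "t > 0 \<Longrightarrow> 1 \<le> real (active t) * t"
proof -
  assume t: "t > 0"
  have "1 / t \<le> real (active t)" unfolding active_def by linarith
  with t show ?thesis by (simp add: field_simps)
qed

text \<open>The range \<open>active t\<close> jumps with \<open>t\<close>. Since stopped generations
  contribute zero, it may be replaced by a range that stays fixed near a given time, as
  differentiation and Lipschitz estimates require.\<close>

lemma sum_dgap_active:
  assumes "t > 0" "1 \<le> real n * t"
  shows "(\<Sum>j<active t. dgap j t * c j) = (\<Sum>j<n. dgap j t * c j)"
proof -
  have *: "(\<Sum>j<m. dgap j t * c j) = (\<Sum>j<max m n. dgap j t * c j)" if "1 \<le> real m * t" for m n
  proof (rule sum.mono_neutral_left)
    show "\<forall>j\<in>{..<max m n} - {..<m}. dgap j t * c j = 0"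
    proof
      fix j assume "j \<in> {..<max m n} - {..<m}"
      then have "real m * t \<le> real (j + 1) * t"
        using assms(1) by (intro mult_right_mono) auto
      with that have "1 \<le> real (j + 1) * t" by linarith
      then show "dgap j t * c j = 0" by (simp add: dgap_frozen)
    qed
  qed auto
  show ?thesis
    using *[OF active_mult_ge_1[OF assms(1)], of n] *[OF assms(2), of "active t"]
    by (simp add: max.commute)
qed

lemma vel_eq:
  assumes "t > 0" "1 \<le> real n * t"
  shows "vel t x = (\<Sum>j<n. dgap j t * (\<Sum>k<2^j. sstep ((x - trajectory t (node j k)) / gap j t)))"
  unfolding vel_def sum_distrib_left[symmetric] by (rule sum_dgap_active[OF assms])

lemma dvel_eq:
  assumes "t > 0" "1 \<le> real n * t"
  shows "dvel t x = (\<Sum>j<n. dgap j t * (\<Sum>k<2^j. 1 / gap j t * dsstep ((x - trajectory t (node j k)) / gap j t)))"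
  using sum_dgap_active[OF assms, of "\<lambda>j. \<Sum>k<2^j. 1 / gap j t * dsstep ((x - trajectory t (node j k)) / gap j t)"]
  by (simp add: dvel_def sum_distrib_left)

lemma total_rate_eq:
  assumes "t > 0" "1 \<le> real n * t"
  shows "total_rate t = (\<Sum>j<n. dgap j t * 2 ^ j)"
  using sum_dgap_active[OF assms, of "\<lambda>j. 2 ^ j"] by (simp add: total_rate_def mult.commute)

section \<open>The velocity on the line\<close>

lemma vel_has_real_derivative: "(vel t has_real_derivative dvel t x) (at x)"
proof -
  have "((\<lambda>x. sstep ((x - a) / b)) has_real_derivative dsstep ((x - a) / b) * (1 / b)) (at x)" for a b
    by (rule DERIV_chain2[OF sstep_has_real_derivative])
       (use DERIV_cdivide[OF DERIV_diff[OF DERIV_ident DERIV_const[of a], of x UNIV], of b] in simp)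
  then have "((\<lambda>x. vel t x) has_real_derivative (\<Sum>j<active t. \<Sum>k<2^j. dgap j t * (dsstep ((x - trajectory t (node j k)) / gap j t) * (1 / gap j t)))) (at x)"
    unfolding vel_def by (intro DERIV_sum DERIV_cmult)
  then show ?thesis by (simp add: dvel_def mult_ac)
qed

lemma vel_nonneg: "vel t x \<ge> 0"
  unfolding vel_def by (intro sum_nonneg mult_nonneg_nonneg dgap_nonneg sstep_nonneg)

lemma vel_le_total_rate: "vel t x \<le> total_rate t"
proof -
  have "vel t x \<le> (\<Sum>j<active t. \<Sum>k<(2^j::nat). dgap j t * 1)"
    unfolding vel_def by (intro sum_mono mult_left_mono sstep_le_1 dgap_nonneg)
  then show ?thesis by (simp add: total_rate_def)
qed

lemma total_rate_nonneg: "total_rate t \<ge> 0"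
  unfolding total_rate_def by (simp add: sum_nonneg dgap_nonneg)

lemma total_rate_le:
  assumes "t > 0"
  shows "total_rate t \<le> 2 / t * radius t"
proof -
  have "total_rate t \<le> (\<Sum>j<active t. 2 / t * (2 * t\<^sup>2 * (1 / (real (j + 1))\<^sup>2)))"
    unfolding total_rate_def
  proof (rule sum_mono)
    fix j
    have "2 ^ j * dgap j t \<le> 2 ^ j * (2 / t * gap j t)"
      using dgap_le[OF assms] by (intro mult_left_mono) auto
    also have "\<dots> = 2 / t * (2 ^ j * gap j t)" by simp
    also have "\<dots> \<le> 2 / t * (2 * t\<^sup>2 * (1 / (real (j + 1))\<^sup>2))"
      using assms by (intro mult_left_mono gap_scaled_le_square) auto
    finally show "2 ^ j * dgap j t \<le> 2 / t * (2 * t\<^sup>2 * (1 / (real (j + 1))\<^sup>2))" .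
  qed
  also have "\<dots> = 2 / t * (2 * t\<^sup>2 * (\<Sum>j<active t. 1 / (real (j + 1))\<^sup>2))"
    by (simp add: sum_distrib_left)
  also have "\<dots> \<le> 2 / t * (2 * t\<^sup>2 * width_const)"
    unfolding width_const_def using assms
    by (intro mult_left_mono sum_le_suminf inverse_square_summable) auto
  finally show ?thesis by (simp add: radius_def mult_ac)
qed

lemma vel_le_0:
  assumes "t > 0" "x \<le> 0"
  shows "vel t x = 0" "dvel t x = 0"
proof -
  have "(x - trajectory t (node j k)) / gap j t \<le> 0" for j k
    using assms trajectory_nonneg[of t "node j k"] gap_pos[OF assms(1), of j] by (intro divide_nonpos_pos) auto
  then show "vel t x = 0" "dvel t x = 0"
    unfolding vel_def dvel_def by (simp_all add: sstep_cases dsstep_cases)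
qed

lemma gap_end_le_radius:
  assumes "k < 2 ^ j"
  shows "trajectory t (node j k) + gap j t \<le> radius t"
proof -
  \<comment> \<open>Any label beyond the node would do; \<open>trajectory_le\<close> bounds every
    real label.\<close>
  have "trajectory t (node j k) + gap j t \<le> trajectory t (node j k + 1)"
    by (rule trajectory_jump[OF assms]) auto
  also have "\<dots> \<le> radius t" unfolding radius_def by (rule trajectory_le)
  finally show ?thesis .
qed

lemma vel_ge_radius:
  assumes "t > 0" "x \<ge> radius t"
  shows "vel t x = total_rate t" "dvel t x = 0"
proof -
  have *: "(x - trajectory t (node j k)) / gap j t \<ge> 1" if "k < 2 ^ j" for j k
    using gap_end_le_radius[OF that, of t] assms gap_pos[OF assms(1), of j] by simp
  show "vel t x = total_rate t"
    unfolding vel_def total_rate_def using * by (intro sum.cong) (simp_all add: sstep_cases)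
  show "dvel t x = 0"
    unfolding dvel_def using * by (intro sum.neutral ballI) (simp_all add: dsstep_cases)
qed

text \<open>No particle is inside an open gap: labels beyond the node are at or past its right end
  by \<open>trajectory_jump\<close>, the others at or before its left end by monotonicity. So the
  smooth steps reproduce the count of nodes and have slope zero at every particle.\<close>

lemma node_position_cases:
  assumes "t > 0" "k < 2 ^ j"
  shows "sstep ((trajectory t \<theta> - trajectory t (node j k)) / gap j t) = of_bool (node j k < \<theta>)"
    and "dsstep ((trajectory t \<theta> - trajectory t (node j k)) / gap j t) = 0"
proof -
  have "(trajectory t \<theta> - trajectory t (node j k)) / gap j t \<ge> 1" if "node j k < \<theta>"
    using trajectory_jump[OF assms(2) order_refl that, of t] gap_pos[OF assms(1), of j] by simp
  moreover have "(trajectory t \<theta> - trajectory t (node j k)) / gap j t \<le> 0" if "\<not> node j k < \<theta>"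
    using trajectory_mono[of \<theta> "node j k" t] that gap_nonneg[of j t] by (simp add: divide_le_0_iff)
  ultimately show "sstep ((trajectory t \<theta> - trajectory t (node j k)) / gap j t) = of_bool (node j k < \<theta>)"
    "dsstep ((trajectory t \<theta> - trajectory t (node j k)) / gap j t) = 0"
    by (cases "node j k < \<theta>"; simp add: sstep_cases dsstep_cases)+
qed

lemma vel_trajectory: "t > 0 \<Longrightarrow> vel t (trajectory t \<theta>) = (\<Sum>j<active t. dgap j t * cnt j \<theta>)"
  unfolding vel_def cnt_def sum_distrib_left
  by (intro sum.cong refl) (simp add: node_position_cases)

lemma dvel_trajectory: "t > 0 \<Longrightarrow> dvel t (trajectory t \<theta>) = 0"
  unfolding dvel_def by (intro sum.neutral ballI) (simp add: node_position_cases)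

lemma trajectory_has_real_derivative_vel:
  assumes "t > 0"
  shows "((\<lambda>t. trajectory t \<theta>) has_real_derivative vel t (trajectory t \<theta>)) (at t)"
proof -
  \<comment> \<open>One extra generation turns the inequality strict, so that it persists near
    \<open>t\<close>.\<close>
  have n: "1 < real (active t + 1) * t"
    using active_mult_ge_1[OF assms] assms by (simp add: algebra_simps)
  have "vel t (trajectory t \<theta>) = (\<Sum>j<active t + 1. dgap j t * cnt j \<theta>)"
    unfolding vel_trajectory[OF assms] by (rule sum_dgap_active[OF assms]) (use n in simp)
  with trajectory_has_real_derivative[OF assms n] show ?thesis by simp
qed

lemma sum_le_if_at_most_one_nonzero:
  fixes f :: "'a \<Rightarrow> real"
  assumes "finite I" "\<And>i. i \<in> I \<Longrightarrow> f i \<le> M" "M \<ge> 0"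
    and "\<And>i j. i \<in> I \<Longrightarrow> j \<in> I \<Longrightarrow> f i \<noteq> 0 \<Longrightarrow> f j \<noteq> 0 \<Longrightarrow> i = j"
  shows "sum f I \<le> M"
proof (cases "\<exists>i\<in>I. f i \<noteq> 0")
  case True
  then obtain i where i: "i \<in> I" "f i \<noteq> 0" by blast
  then have "sum f I = sum f {i}"
    using assms by (intro sum.mono_neutral_right) auto
  with i assms show ?thesis by simp
next
  case False
  then have "sum f I = 0" by (intro sum.neutral) auto
  with assms show ?thesis by simp
qed

lemma dvel_nonneg: "dvel t x \<ge> 0"
  unfolding dvel_def by (intro sum_nonneg mult_nonneg_nonneg divide_nonneg_nonneg dgap_nonneg dsstep_nonneg gap_nonneg)

text \<open>At most one summand is nonzero, because the gaps are disjoint.\<close>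

lemma dvel_le:
  assumes "t > 0"
  shows "dvel t x \<le> 4 / t"
proof -
  have in_gap: "trajectory t (node j k) < x \<and> x < trajectory t (node j k) + gap j t"
    if "dsstep ((x - trajectory t (node j k)) / gap j t) \<noteq> 0" for j k
  proof -
    have "0 < (x - trajectory t (node j k)) / gap j t" "(x - trajectory t (node j k)) / gap j t < 1"
      using that dsstep_cases(1,4) by (meson not_le)+
    with gap_pos[OF assms, of j] show ?thesis by (simp add: field_simps)
  qed
  have "dvel t x = (\<Sum>(j, k)\<in>Sigma {..<active t} (\<lambda>j. {..<2^j}). dgap j t / gap j t * dsstep ((x - trajectory t (node j k)) / gap j t))"
    unfolding dvel_def by (rule sum.Sigma) auto
  also have "\<dots> \<le> 4 / t"
  proof (rule sum_le_if_at_most_one_nonzero, goal_cases)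
    case (2 i)
    obtain j k where i: "i = (j, k)" by (cases i)
    have "dgap j t / gap j t \<le> 2 / t"
      using dgap_le[OF assms, of j] gap_pos[OF assms, of j] by (simp add: divide_le_eq)
    then have "dgap j t / gap j t * dsstep ((x - trajectory t (node j k)) / gap j t) \<le> 2 / t * 2"
      using assms by (intro mult_mono dsstep_le_2 dsstep_nonneg) auto
    with i show ?case by simp
  next
    case (4 i i')
    obtain j k j' k' where i: "i = (j, k)" "i' = (j', k')" by (cases i, cases i')
    have k: "k < 2 ^ j" "k' < 2 ^ j'" using 4 i by auto
    have g: "trajectory t (node j k) < x" "x < trajectory t (node j k) + gap j t"
      "trajectory t (node j' k') < x" "x < trajectory t (node j' k') + gap j' t"
      using in_gap[of j k] in_gap[of j' k'] 4 i by auto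
    \<comment> \<open>Otherwise the gap at the smaller node would end before the other one begins,
      while \<open>x\<close> lies in both.\<close>
    have "\<not> node j k < node j' k'"
      using trajectory_jump[OF k(1) order_refl, of "node j' k'" t] g by linarith
    moreover have "\<not> node j' k' < node j k"
      using trajectory_jump[OF k(2) order_refl, of "node j k" t] g by linarith
    ultimately have "node j k = node j' k'" by linarith
    then show ?case using node_inject i by blast
  qed (use assms in auto)
  finally show ?thesis .
qed

text \<open>The stream function is \<open>F(x\<^sub>1) G(x\<^sub>2) - G(x\<^sub>1) F(x\<^sub>2)\<close>, where \<open>F = profile t\<close> and \<open>G = cutid t\<close> are compactly
  supported versions of \<open>vel t\<close> and of the identity.\<close>

definition bump_id :: "real \<Rightarrow> real" where
  "bump_id y = y * (sstep (y + 2) * sstep (2 - y))"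

definition dbump_id :: "real \<Rightarrow> real" where
  "dbump_id y = sstep (y + 2) * sstep (2 - y) + y * (dsstep (y + 2) * sstep (2 - y) - sstep (y + 2) * dsstep (2 - y))"

lemma bump_id_has_real_derivative: "(bump_id has_real_derivative dbump_id y) (at y)"
proof -
  have "((\<lambda>y. sstep (y + 2)) has_real_derivative dsstep (y + 2) * 1) (at y)"
    "((\<lambda>y. sstep (2 - y)) has_real_derivative dsstep (2 - y) * (- 1)) (at y)"
    by (rule DERIV_chain2[OF sstep_has_real_derivative]; auto intro!: derivative_eq_intros)+
  from DERIV_mult[OF DERIV_ident DERIV_mult[OF this]] show ?thesis
    unfolding bump_id_def[abs_def] by (rule DERIV_cong) (simp add: dbump_id_def algebra_simps)
qed

lemma bump_id_outside:
  assumes "\<bar>y\<bar> \<ge> 2"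
  shows "bump_id y = 0" "dbump_id y = 0"
proof -
  from assms consider "y + 2 \<le> 0" | "2 - y \<le> 0" by linarith
  then show "bump_id y = 0" "dbump_id y = 0"
    by (cases; simp add: bump_id_def dbump_id_def sstep_cases dsstep_cases)+
qed

lemma bump_id_inside: "0 \<le> y \<Longrightarrow> y \<le> 1 \<Longrightarrow> bump_id y = y" "0 \<le> y \<Longrightarrow> y \<le> 1 \<Longrightarrow> dbump_id y = 1"
  by (auto simp: bump_id_def dbump_id_def sstep_cases dsstep_cases)

lemma abs_bump_id_le: "\<bar>bump_id y\<bar> \<le> 2"
proof (cases "\<bar>y\<bar> \<ge> 2")
  case False
  have "\<bar>bump_id y\<bar> = \<bar>y\<bar> * (sstep (y + 2) * sstep (2 - y))"
    by (simp add: bump_id_def abs_mult sstep_nonneg)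
  also have "\<dots> \<le> 2 * (1 * 1)"
    using False by (intro mult_mono sstep_le_1 mult_nonneg_nonneg sstep_nonneg) auto
  finally show ?thesis by simp
qed (simp add: bump_id_outside)

lemma abs_dbump_id_le: "\<bar>dbump_id y\<bar> \<le> 9"
proof (cases "\<bar>y\<bar> \<ge> 2")
  case False
  have a: "\<bar>sstep z\<bar> \<le> 1" "\<bar>dsstep z\<bar> \<le> 2" for z
    using sstep_nonneg sstep_le_1 dsstep_nonneg dsstep_le_2 by (simp_all add: abs_of_nonneg)
  have "\<bar>p * q + y * (p' * q - p * q')\<bar> \<le> \<bar>p\<bar> * \<bar>q\<bar> + \<bar>y\<bar> * (\<bar>p'\<bar> * \<bar>q\<bar> + \<bar>p\<bar> * \<bar>q'\<bar>)" for p q p' q'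
  proof -
    have "\<bar>p * q + y * (p' * q - p * q')\<bar> \<le> \<bar>p * q\<bar> + \<bar>y\<bar> * \<bar>p' * q - p * q'\<bar>"
      by (metis abs_mult abs_triangle_ineq)
    also have "\<dots> \<le> \<bar>p * q\<bar> + \<bar>y\<bar> * (\<bar>p' * q\<bar> + \<bar>p * q'\<bar>)"
      by (intro add_left_mono mult_left_mono abs_triangle_ineq4) auto
    finally show ?thesis by (simp add: abs_mult)
  qed
  then have "\<bar>dbump_id y\<bar> \<le> \<bar>sstep (y + 2)\<bar> * \<bar>sstep (2 - y)\<bar> + \<bar>y\<bar> * (\<bar>dsstep (y + 2)\<bar> * \<bar>sstep (2 - y)\<bar> + \<bar>sstep (y + 2)\<bar> * \<bar>dsstep (2 - y)\<bar>)"
    unfolding dbump_id_def .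
  also have "\<dots> \<le> 1 * 1 + 2 * (2 * 1 + 1 * 2)"
    using False by (intro add_mono mult_mono a) auto
  finally show ?thesis by simp
qed (simp add: bump_id_outside)

text \<open>To the right of \<open>radius t\<close> the velocity is constant, so subtracting a step
  of that height between one and two radii gives compact support without altering anything up to one
  radius.\<close>

definition profile :: "real \<Rightarrow> real \<Rightarrow> real" where
  "profile t x = vel t x - total_rate t * sstep (x / radius t - 1)"

definition dprofile :: "real \<Rightarrow> real \<Rightarrow> real" where
  "dprofile t x = dvel t x - total_rate t / radius t * dsstep (x / radius t - 1)"

definition cutid :: "real \<Rightarrow> real \<Rightarrow> real" where
  "cutid t x = radius t * bump_id (x / radius t)"

definition dcutid :: "real \<Rightarrow> real \<Rightarrow> real" where
  "dcutid t x = dbump_id (x / radius t)"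

text \<open>The rotated gradient of the stream function: its derivative in the second variable, then
  minus its derivative in the first.\<close>

definition velocity :: "real \<Rightarrow> real^2 \<Rightarrow> real^2" where
  "velocity t x = vector [profile t (x $ 1) * dcutid t (x $ 2) - cutid t (x $ 1) * dprofile t (x $ 2),
                          dcutid t (x $ 1) * profile t (x $ 2) - dprofile t (x $ 1) * cutid t (x $ 2)]"

section \<open>Support and size of the velocity field\<close>

lemma profile_has_real_derivative: "(profile t has_real_derivative dprofile t x) (at x)"
proof -
  have "((\<lambda>x. sstep (x / radius t - 1)) has_real_derivative dsstep (x / radius t - 1) * (1 / radius t)) (at x)"
    by (rule DERIV_chain2[OF sstep_has_real_derivative])
       (use DERIV_diff[OF DERIV_cdivide[OF DERIV_ident] DERIV_const] in auto)
  from DERIV_diff[OF vel_has_real_derivative DERIV_cmult[OF this, of "total_rate t"]] show ?thesis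
    unfolding profile_def[abs_def] by (rule DERIV_cong) (simp add: dprofile_def)
qed

lemma cutid_has_real_derivative: "t > 0 \<Longrightarrow> (cutid t has_real_derivative dcutid t x) (at x)"
proof -
  assume "t > 0"
  have "((\<lambda>x. bump_id (x / radius t)) has_real_derivative dbump_id (x / radius t) * (1 / radius t)) (at x)"
    by (rule DERIV_chain2[OF bump_id_has_real_derivative]) (rule DERIV_cdivide[OF DERIV_ident])
  from DERIV_cmult[OF this, of "radius t"] show ?thesis
    unfolding cutid_def[abs_def] by (rule DERIV_cong) (use radius_pos[OF \<open>t > 0\<close>] in \<open>simp add: dcutid_def\<close>)
qed

lemma stream_factors_outside:
  assumes t: "t > 0" and x: "\<bar>x\<bar> \<ge> 2 * radius t"
  shows "profile t x = 0" "dprofile t x = 0" "cutid t x = 0" "dcutid t x = 0"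
proof -
  note R = radius_pos[OF t]
  have "\<bar>x / radius t\<bar> \<ge> 2" using x R by (simp add: abs_divide le_divide_eq)
  then show "cutid t x = 0" "dcutid t x = 0" by (simp_all add: cutid_def dcutid_def bump_id_outside)
  have "profile t x = 0 \<and> dprofile t x = 0"
  proof (cases "x \<le> 0")
    case True
    then have "x / radius t - 1 \<le> 0" using R by (simp add: field_simps)
    with True t show ?thesis by (simp add: profile_def dprofile_def vel_le_0 sstep_cases dsstep_cases)
  next
    case False
    then have 1: "x / radius t - 1 \<ge> 1" using x R by (simp add: field_simps)
    have "x \<ge> radius t" using False x R by linarith
    with t 1 show ?thesis by (simp add: profile_def dprofile_def vel_ge_radius sstep_cases dsstep_cases)
  qed
  then show "profile t x = 0" "dprofile t x = 0" by auto
qed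

lemma stream_factors_inside:
  assumes t: "t > 0" and x: "0 \<le> x" "x \<le> radius t"
  shows "profile t x = vel t x" "dprofile t x = dvel t x" "cutid t x = x" "dcutid t x = 1"
proof -
  note R = radius_pos[OF t]
  have "0 \<le> x / radius t" "x / radius t \<le> 1" using x R by (auto simp: divide_le_eq)
  then show "profile t x = vel t x" "dprofile t x = dvel t x" "cutid t x = x" "dcutid t x = 1"
    using R by (simp_all add: profile_def dprofile_def cutid_def dcutid_def bump_id_inside sstep_cases dsstep_cases)
qed

text \<open>In \<open>velocity\<close> the large factor \<open>dprofile\<close>, of order 1 / t, is
  always multiplied by \<open>cutid\<close>, of order t^2, and \<open>profile\<close>, of order t,
  by the bounded \<open>dcutid\<close>. Both products are of order t.\<close>

lemma stream_factors_bounds: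
  assumes t: "t > 0"
  shows "\<bar>profile t x\<bar> \<le> 4 * width_const * t" "\<bar>dprofile t x\<bar> \<le> 8 / t"
    "\<bar>cutid t x\<bar> \<le> 4 * width_const * t\<^sup>2" "\<bar>dcutid t x\<bar> \<le> 9"
proof -
  note R = radius_pos[OF t]
  have H: "total_rate t \<le> 4 * width_const * t"
    using total_rate_le[OF t] t by (simp add: radius_def power2_eq_square field_simps)
  have HR: "total_rate t / radius t \<le> 2 / t"
    using total_rate_le[OF t] R by (simp add: divide_le_eq)
  have "0 \<le> total_rate t * sstep (x / radius t - 1)"
    by (intro mult_nonneg_nonneg total_rate_nonneg sstep_nonneg)
  moreover have "total_rate t * sstep (x / radius t - 1) \<le> total_rate t * 1"
    by (intro mult_left_mono total_rate_nonneg sstep_le_1)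
  ultimately show "\<bar>profile t x\<bar> \<le> 4 * width_const * t"
    using vel_nonneg[of t x] vel_le_total_rate[of t x] H by (simp add: profile_def)
  have "0 \<le> total_rate t / radius t * dsstep (x / radius t - 1)"
    using R by (intro mult_nonneg_nonneg divide_nonneg_nonneg total_rate_nonneg dsstep_nonneg) auto
  moreover have "total_rate t / radius t * dsstep (x / radius t - 1) \<le> 2 / t * 2"
    using t by (intro mult_mono HR dsstep_le_2 dsstep_nonneg) auto
  moreover have "4 / t > 0" "8 / t = 4 / t + 4 / t" using t by auto
  ultimately show "\<bar>dprofile t x\<bar> \<le> 8 / t"
    using dvel_nonneg[of t x] dvel_le[OF t, of x] unfolding dprofile_def by (simp add: abs_le_iff)
  have "\<bar>cutid t x\<bar> \<le> radius t * 2"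
    unfolding cutid_def abs_mult using R by (intro mult_mono abs_bump_id_le) auto
  then show "\<bar>cutid t x\<bar> \<le> 4 * width_const * t\<^sup>2" by (simp add: radius_def)
  show "\<bar>dcutid t x\<bar> \<le> 9" by (simp add: dcutid_def abs_dbump_id_le)
qed

lemma velocity_0 [simp]: "velocity 0 x = 0"
proof -
  have "dgap j 0 = 0" for j by (simp add: dgap_def dsstep_cases)
  then have "profile 0 y = 0" "dprofile 0 y = 0" for y
    by (simp_all add: profile_def dprofile_def vel_def dvel_def total_rate_def)
  then show ?thesis by (simp add: velocity_def vec_eq_iff forall_2)
qed

text \<open>All generations have stopped by time 1, which gives compact support in time.\<close>

lemma velocity_frozen: "t \<ge> 1 \<Longrightarrow> velocity t x = 0"
proof -
  assume "t \<ge> 1"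
  then have "1 * 1 \<le> real (j + 1) * t" for j by (intro mult_mono) auto
  then have "dgap j t = 0" for j by (intro dgap_frozen) simp
  then have "profile t y = 0" "dprofile t y = 0" for y
    by (simp_all add: profile_def dprofile_def vel_def dvel_def total_rate_def)
  then show ?thesis by (simp add: velocity_def vec_eq_iff forall_2)
qed

text \<open>Every product in \<open>velocity\<close> has one factor in each coordinate, so a single
  large coordinate suffices.\<close>

lemma velocity_outside:
  assumes "t \<ge> 0" "\<bar>x $ i\<bar> \<ge> 2 * radius t"
  shows "velocity t x = 0"
proof (cases "t = 0")
  case False
  with assms have "t > 0" by simp
  moreover have "i = 1 \<or> i = 2" using exhaust_2 by blast
  ultimately show ?thesis
    using assms(2) by (auto simp: velocity_def vec_eq_iff forall_2 stream_factors_outside)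
qed simp

lemma abs_velocity_component_le:
  assumes t: "t > 0"
  shows "\<bar>velocity t x $ i\<bar> \<le> 68 * width_const * t"
proof -
  note K = width_const_pos
  \<comment> \<open>The constant is 68 = 4 * 9 + 4 * 8, from the four bounds on the factors.\<close>
  have *: "\<bar>a * b - c * d\<bar> \<le> 68 * width_const * t"
    if "\<bar>a\<bar> \<le> 4 * width_const * t" "\<bar>b\<bar> \<le> 9" "\<bar>c\<bar> \<le> 4 * width_const * t\<^sup>2" "\<bar>d\<bar> \<le> 8 / t" for a b c d
  proof -
    have "\<bar>a * b - c * d\<bar> \<le> \<bar>a\<bar> * \<bar>b\<bar> + \<bar>c\<bar> * \<bar>d\<bar>" by (metis abs_mult abs_triangle_ineq4)
    also have "\<dots> \<le> (4 * width_const * t) * 9 + (4 * width_const * t\<^sup>2) * (8 / t)"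
      using that t K by (intro add_mono mult_mono) auto
    finally show ?thesis using t by (simp add: power2_eq_square)
  qed
  have "i = 1 \<or> i = 2" using exhaust_2 by blast
  then show ?thesis
    using *[OF stream_factors_bounds(1,4,3,2)[OF t], of "x $ 1" "x $ 2" "x $ 1" "x $ 2"]
      *[OF stream_factors_bounds(1,4,3,2)[OF t], of "x $ 2" "x $ 1" "x $ 2" "x $ 1"]
    by (auto simp: velocity_def mult.commute[of "dcutid t (x $ 1)"] mult.commute[of "dprofile t (x $ 1)"])
qed

lemma velocity_at_trajectory:
  assumes t: "t > 0"
  shows "velocity t (vector [trajectory t a, trajectory t b]) = vector [vel t (trajectory t a), vel t (trajectory t b)]"
proof -
  have "0 \<le> trajectory t c" "trajectory t c \<le> radius t" for c
    by (simp_all add: trajectory_nonneg trajectory_le radius_def)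
  then show ?thesis using t by (simp add: velocity_def stream_factors_inside dvel_trajectory vec_eq_iff forall_2)
qed

section \<open>Lipschitz and uniform continuity of the field\<close>

lemma lipschitz_near_ident: "lipschitz_near p (\<lambda>x. x)"
  by (rule lipschitz_nearI[OF lipschitz_on_id])

lemma lipschitz_near_sstep: "lipschitz_near p f \<Longrightarrow> lipschitz_near p (\<lambda>x. sstep (f x))"
  by (rule lipschitz_near_compose[OF _ lipschitz_nearI[OF sstep_lipschitz]])

lemma lipschitz_near_dsstep: "lipschitz_near p f \<Longrightarrow> lipschitz_near p (\<lambda>x. dsstep (f x))"
  by (rule lipschitz_near_compose[OF _ lipschitz_nearI[OF dsstep_lipschitz]])

lemmas lipschitz_near_intros =
  lipschitz_near_const lipschitz_near_ident lipschitz_near_fst lipschitz_near_snd lipschitz_near_add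
  lipschitz_near_diff lipschitz_near_mult lipschitz_near_divide lipschitz_near_sum
  lipschitz_near_sstep lipschitz_near_dsstep

lemma lipschitz_near_gap: "lipschitz_near t (gap j)" "lipschitz_near t (dgap j)"
  unfolding gap_def[abs_def] dgap_def[abs_def] by (intro lipschitz_near_intros; simp)+

lemma lipschitz_near_trajectory: "lipschitz_near t (\<lambda>t. trajectory t \<theta>)"
  by (rule lipschitz_nearI[OF trajectory_lipschitz])

lemma lipschitz_near_radius: "lipschitz_near t radius"
  unfolding radius_def[abs_def] power2_eq_square by (intro lipschitz_near_intros)

lemma lipschitz_near_vel:
  assumes t: "t > 0"
  shows "lipschitz_near (t, x) (\<lambda>(t, x). vel t x)" "lipschitz_near (t, x) (\<lambda>(t, x). dvel t x)"
    "lipschitz_near (t, x) (\<lambda>(t, x). total_rate t)"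
proof -
  \<comment> \<open>A number of generations that covers all moving ones throughout the neighbourhood
    \<open>U\<close>, so the velocity is there a finite sum with fixed range.\<close>
  obtain n where n: "1 / t < real n" using reals_Archimedean2 by blast
  then have n0: "real n > 0" using t by (meson less_trans zero_less_divide_1_iff)
  define U where "U = {1 / real n<..} \<times> (UNIV :: real set)"
  have U: "open U" "(t, x) \<in> U"
    using n n0 t by (auto simp: U_def open_Times field_simps)
  have pU: "fst p > 0" "1 \<le> real n * fst p" if "p \<in> U" for p
  proof -
    have "1 / real n < fst p" using that by (auto simp: U_def)
    with n0 show "fst p > 0" "1 \<le> real n * fst p"
      by (auto simp: field_simps intro: less_trans[of 0 "1 / real n"])
  qed
  have g: "lipschitz_near (t, x) (\<lambda>p. gap j (fst p))" "lipschitz_near (t, x) (\<lambda>p. dgap j (fst p))"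
    "lipschitz_near (t, x) (\<lambda>p. trajectory (fst p) \<theta>)" for j \<theta>
    by (rule lipschitz_near_compose[OF lipschitz_near_fst] lipschitz_near_gap lipschitz_near_trajectory)+
  note gp = gap_pos[OF t, THEN less_imp_neq, symmetric]
  have 1: "lipschitz_near (t, x) (\<lambda>p. \<Sum>j<n. dgap j (fst p) * (\<Sum>k<2^j. sstep ((snd p - trajectory (fst p) (node j k)) / gap j (fst p))))"
    by (intro lipschitz_near_intros g) (simp add: gp)
  show "lipschitz_near (t, x) (\<lambda>(t, x). vel t x)"
    by (rule lipschitz_near_transform[OF 1 U]) (simp add: vel_eq[OF pU] case_prod_unfold)
  have 2: "lipschitz_near (t, x) (\<lambda>p. \<Sum>j<n. dgap j (fst p) * (\<Sum>k<2^j. 1 / gap j (fst p) * dsstep ((snd p - trajectory (fst p) (node j k)) / gap j (fst p))))"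
    by (intro lipschitz_near_intros g) (simp_all add: gp)
  show "lipschitz_near (t, x) (\<lambda>(t, x). dvel t x)"
    by (rule lipschitz_near_transform[OF 2 U]) (simp add: dvel_eq[OF pU] case_prod_unfold)
  have 3: "lipschitz_near (t, x) (\<lambda>p. \<Sum>j<n. dgap j (fst p) * 2 ^ j)"
    by (intro lipschitz_near_intros g)
  show "lipschitz_near (t, x) (\<lambda>(t, x). total_rate t)"
    by (rule lipschitz_near_transform[OF 3 U]) (simp add: total_rate_eq[OF pU] case_prod_unfold)
qed

lemma lipschitz_near_stream_factors:
  assumes t: "t > 0"
  shows "lipschitz_near (t, x) (\<lambda>(t, x). profile t x)" "lipschitz_near (t, x) (\<lambda>(t, x). dprofile t x)"
    "lipschitz_near (t, x) (\<lambda>(t, x). cutid t x)" "lipschitz_near (t, x) (\<lambda>(t, x). dcutid t x)"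
proof -
  note v = lipschitz_near_vel[OF t, of x, unfolded case_prod_unfold]
  have r: "lipschitz_near (t, x) (\<lambda>p. radius (fst p))"
    by (rule lipschitz_near_compose[OF lipschitz_near_fst lipschitz_near_radius])
  have r0: "radius t \<noteq> 0" using radius_pos[OF t] by simp
  show "lipschitz_near (t, x) (\<lambda>(t, x). profile t x)" "lipschitz_near (t, x) (\<lambda>(t, x). dprofile t x)"
    "lipschitz_near (t, x) (\<lambda>(t, x). cutid t x)" "lipschitz_near (t, x) (\<lambda>(t, x). dcutid t x)"
    unfolding profile_def dprofile_def cutid_def dcutid_def bump_id_def dbump_id_def case_prod_unfold
    by (intro lipschitz_near_intros v r; simp add: r0)+
qed

lemma lipschitz_near_velocity:
  assumes t: "t > 0"
  shows "lipschitz_near (t, x) (\<lambda>(t, x). velocity t x)"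
proof -
  have c: "lipschitz_near (t, x) (\<lambda>p. (fst p, snd p $ i))" for i
    by (intro lipschitz_near_Pair lipschitz_near_fst lipschitz_near_compose[OF lipschitz_near_snd lipschitz_near_vec_component])
  have s: "lipschitz_near (t, x) (\<lambda>p. f (fst p) (snd p $ i))" if "\<And>y. lipschitz_near (t, y) (\<lambda>(t, x). f t x)" for f :: "real \<Rightarrow> real \<Rightarrow> real" and i
    using lipschitz_near_compose[OF c, of i "\<lambda>(t, x). f t x"] that by simp
  show ?thesis
    unfolding velocity_def case_prod_unfold
    by (intro lipschitz_near_vector_2 lipschitz_near_mult lipschitz_near_diff s lipschitz_near_stream_factors[OF t])
qed

lemma radius_mono: "0 \<le> s \<Longrightarrow> s \<le> t \<Longrightarrow> radius s \<le> radius t"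
  unfolding radius_def using width_const_pos by (intro mult_left_mono power_mono) auto

lemma velocity_locally_lipschitz:
  "locally_lipschitz_on ({0..} \<times> (UNIV - {0})) (\<lambda>(t, x). velocity t x)"
  unfolding locally_lipschitz_on_def
proof
  fix p :: "real \<times> (real^2)" assume p: "p \<in> {0..} \<times> (UNIV - {0})"
  obtain t x where tx: "p = (t, x)" by (cases p)
  have t: "t \<ge> 0" and x: "x \<noteq> 0" using p tx by auto
  show "\<exists>e>0. \<exists>L. \<forall>q\<in>{0..} \<times> (UNIV - {0}) \<inter> ball p e. \<forall>r\<in>{0..} \<times> (UNIV - {0}) \<inter> ball p e.
      dist (case q of (t, x) \<Rightarrow> velocity t x) (case r of (t, x) \<Rightarrow> velocity t x) \<le> L * dist q r"
  proof (cases "t > 0")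
    case True
    from lipschitz_nearE[OF lipschitz_near_velocity[OF True, of x]] obtain e L where
      e: "e > 0" "L-lipschitz_on (ball p e) (\<lambda>(t, x). velocity t x)" unfolding tx by metis
    show ?thesis
      by (intro exI[of _ e] exI[of _ L] conjI ballI e(1)) (rule lipschitz_onD[OF e(2)]; simp)
  next
    case False
    with t have t0: "t = 0" by simp
    obtain i where i: "x $ i \<noteq> 0" using x by (auto simp: vec_eq_iff)
    define d where "d = \<bar>x $ i\<bar>"
    \<comment> \<open>The first bound keeps the i-th coordinate at least d / 2 in modulus, the
      second gives s^2 \<le> s, and the third then makes the support radius 4
      \<open>width_const\<close> s^2 at most d / 2. So the field vanishes at all nonnegative times
      in this ball.\<close>
    define e where "e = min (d / 2) (min 1 (d / (8 * width_const)))"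
    have d: "d > 0" using i by (simp add: d_def)
    have e: "e > 0" using d width_const_pos by (simp add: e_def)
    have z: "velocity s y = 0" if "s \<ge> 0" "(s, y) \<in> ball p e" for s y
    proof (rule velocity_outside[OF that(1)])
      have "dist t s < e" "dist x y < e"
        using that(2) dist_fst_le[of p "(s, y)"] dist_snd_le[of p "(s, y)"] tx by auto
      then have s: "s < e" and "dist (x $ i) (y $ i) < e"
        using t0 that(1) dist_vec_nth_le[of x i y] by (auto simp: dist_real_def)
      then have "\<bar>x $ i - y $ i\<bar> < d / 2" by (simp add: dist_real_def e_def)
      then have y: "\<bar>y $ i\<bar> \<ge> d / 2" unfolding d_def by linarith
      have "s\<^sup>2 \<le> s * 1" unfolding power2_eq_square using that(1) s by (intro mult_left_mono) (auto simp: e_def)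
      then have "2 * radius s \<le> 4 * width_const * s"
        using width_const_pos by (simp add: radius_def)
      also have "\<dots> \<le> 4 * width_const * (d / (8 * width_const))"
        using s width_const_pos by (intro mult_left_mono) (auto simp: e_def)
      also have "\<dots> = d / 2" using width_const_pos by simp
      finally show "2 * radius s \<le> \<bar>y $ i\<bar>" using y by linarith
    qed
    show ?thesis
      by (intro exI[of _ e] exI[of _ 0] conjI e ballI) (auto simp: z)
  qed
qed

lemma norm_velocity_le:
  assumes "t \<ge> 0"
  shows "norm (velocity t x) \<le> 136 * width_const * t"
proof (cases "t = 0")
  case False
  with assms have "t > 0" by simp
  have "norm (velocity t x) \<le> \<bar>velocity t x $ 1\<bar> + \<bar>velocity t x $ 2\<bar>"
    using norm_le_l1_cart[of "velocity t x"] by (simp add: sum_2)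
  with abs_velocity_component_le[OF \<open>t > 0\<close>, of x 1] abs_velocity_component_le[OF \<open>t > 0\<close>, of x 2]
  show ?thesis by linarith
qed simp

lemma velocity_compact_support:
  obtains K where "compact K" "\<And>t x. t \<ge> 0 \<Longrightarrow> (t, x) \<notin> K \<Longrightarrow> velocity t x = 0"
proof
  show "compact ({0..1::real} \<times> cball (0 :: real^2) (4 * radius 1))"
    by (intro compact_Times compact_cball compact_Icc)
  fix t :: real and x :: "real^2"
  assume t: "t \<ge> 0" and n: "(t, x) \<notin> {0..1} \<times> cball 0 (4 * radius 1)"
  show "velocity t x = 0"
  proof (cases "t \<ge> 1")
    case False
    then have "norm x > 4 * radius 1" using t n by auto
    moreover have "norm x \<le> \<bar>x $ 1\<bar> + \<bar>x $ 2\<bar>"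
      using norm_le_l1_cart[of x] by (simp add: sum_2)
    ultimately have "\<bar>x $ 1\<bar> \<ge> 2 * radius 1 \<or> \<bar>x $ 2\<bar> \<ge> 2 * radius 1" by linarith
    moreover have "radius t \<le> radius 1" using t False by (intro radius_mono) auto
    ultimately show ?thesis using velocity_outside[OF t] by (meson mult_left_mono order_trans zero_le_numeral)
  qed (rule velocity_frozen)
qed

text \<open>Continuity at positive times is part of the local Lipschitz property; at time 0 it
  follows from the bound of order t, also at the origin. Compact support then makes it
  uniform.\<close>

lemma velocity_uniformly_continuous:
  "uniformly_continuous_on ({0..} \<times> UNIV) (\<lambda>(t, x). velocity t x)"
proof -
  obtain K where K: "compact K" "\<And>t x. t \<ge> 0 \<Longrightarrow> (t, x) \<notin> K \<Longrightarrow> velocity t x = 0"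
    using velocity_compact_support by blast
  have "continuous_on ({0..} \<times> UNIV) (\<lambda>(t, x). velocity t x)"
    unfolding continuous_on_eq_continuous_within
  proof
    fix p :: "real \<times> (real^2)" assume "p \<in> {0..} \<times> UNIV"
    then obtain t x where p: "p = (t, x)" "t \<ge> 0" by auto
    show "continuous (at p within {0..} \<times> UNIV) (\<lambda>(t, x). velocity t x)"
    proof (cases "t > 0")
      case True
      then show ?thesis
        using lipschitz_near_imp_continuous[OF lipschitz_near_velocity[OF True, of x]] p
        by (auto intro: continuous_at_imp_continuous_at_within)
    next
      case False
      with p have t0: "t = 0" by simp
      have "((\<lambda>q. case q of (t, x) \<Rightarrow> velocity t x) \<longlongrightarrow> 0) (at p within {0..} \<times> UNIV)"
      proof (rule Lim_null_comparison)
        show "\<forall>\<^sub>F q in at p within {0..} \<times> UNIV. norm (case q of (t, x) \<Rightarrow> velocity t x) \<le> 136 * width_const * fst q"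
          unfolding eventually_at_filter using norm_velocity_le by (intro always_eventually) auto
        have "((\<lambda>q. 136 * width_const * fst q) \<longlongrightarrow> 136 * width_const * fst p) (at p within {0..} \<times> UNIV)"
          by (intro tendsto_intros)
        then show "((\<lambda>q. 136 * width_const * fst q) \<longlongrightarrow> 0) (at p within {0..} \<times> UNIV)"
          by (simp add: p t0)
      qed
      then show ?thesis by (simp add: continuous_within p t0)
    qed
  qed
  then show ?thesis
    by (rule uniformly_continuous_on_compact_support[OF _ _ K(1)]) (use K(2) in \<open>auto intro: closed_Times\<close>)
qed

lemma continuous_on_stream_factors:
  assumes t: "t > 0"
  shows "continuous_on UNIV (profile t)" "continuous_on UNIV (dprofile t)"
    "continuous_on UNIV (cutid t)" "continuous_on UNIV (dcutid t)"
proof -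
  have "continuous_on UNIV (f t)" if "\<And>y. lipschitz_near (t, y) (\<lambda>(t, x). f t x)" for f :: "real \<Rightarrow> real \<Rightarrow> real"
  proof (rule continuous_at_imp_continuous_on, rule ballI)
    fix y :: real
    have "lipschitz_near y (\<lambda>y. (t, y))" by (intro lipschitz_near_Pair lipschitz_near_intros)
    then have "lipschitz_near y (\<lambda>y. case (t, y) of (t, x) \<Rightarrow> f t x)"
      by (rule lipschitz_near_compose) (rule that)
    then show "isCont (f t) y"
      using lipschitz_near_imp_continuous by fastforce
  qed
  then show "continuous_on UNIV (profile t)" "continuous_on UNIV (dprofile t)"
    "continuous_on UNIV (cutid t)" "continuous_on UNIV (dcutid t)"
    using lipschitz_near_stream_factors[OF t] by blast+
qed

lemma velocity_weakly_div_free: "weakly_div_free velocity"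
  unfolding weakly_div_free_def
proof (intro allI impI)
  fix t :: real and \<phi> :: "real^2 \<Rightarrow> real"
  assume "t \<ge> 0" and \<phi>: "test_fun \<phi>"
  show "(\<integral>x. frechet_derivative \<phi> (at x) (velocity t x) \<partial>lborel) = 0"
  proof (cases "t = 0")
    case True
    have "frechet_derivative \<phi> (at x) 0 = 0" for x
      using has_derivative_bounded_linear[OF test_fun_has_derivative[OF \<phi>, of x]] by (rule linear_simps(3))
    then show ?thesis by (simp add: True)
  next
    case False
    with \<open>t \<ge> 0\<close> have t: "t > 0" by simp
    \<comment> \<open>The stream function at time \<open>t\<close>. The argument uses only its
      continuous first derivatives, which is the regularity that
      \<open>integral_skew_gradient_test_fun\<close> asks for.\<close>
    define \<psi> where "\<psi> x = profile t (x $ 1) * cutid t (x $ 2) - cutid t (x $ 1) * profile t (x $ 2)" for x :: "real^2"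
    define D\<psi> where "D\<psi> x h = (profile t (x $ 1) * (dcutid t (x $ 2) * h $ 2) + dprofile t (x $ 1) * h $ 1 * cutid t (x $ 2)) -
      (cutid t (x $ 1) * (dprofile t (x $ 2) * h $ 2) + dcutid t (x $ 1) * h $ 1 * profile t (x $ 2))" for x h :: "real^2"
    have comp: "((\<lambda>x. f (x $ i)) has_derivative (\<lambda>h. f' (x $ i) * h $ i)) (at x)"
      if "\<And>y. (f has_real_derivative f' y) (at y)" for f f' :: "real \<Rightarrow> real" and x :: "real^2" and i
      by (rule has_derivative_compose[OF bounded_linear_imp_has_derivative[OF bounded_linear_vec_nth]
            that[unfolded has_field_derivative_def]])
    have d\<psi>: "(\<psi> has_derivative D\<psi> x) (at x)" for x
      unfolding \<psi>_def[abs_def] D\<psi>_def[abs_def]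
      by (intro has_derivative_diff has_derivative_mult comp profile_has_real_derivative cutid_has_real_derivative[OF t])
    have cc: "continuous_on UNIV (\<lambda>x. f (x $ i))" if "continuous_on UNIV f" for f :: "real \<Rightarrow> real" and i :: 2
      by (rule continuous_on_compose2[OF that]) (auto intro!: continuous_intros)
    have cD: "continuous_on UNIV (\<lambda>x. D\<psi> x e)" for e
      unfolding D\<psi>_def by (intro continuous_intros cc continuous_on_stream_factors[OF t])
    have z: "\<psi> x = 0" if x: "x \<notin> cball 0 (4 * radius t)" for x
    proof -
      have "norm x \<le> \<bar>x $ 1\<bar> + \<bar>x $ 2\<bar>"
        using norm_le_l1_cart[of x] by (simp add: sum_2)
      with x have "\<bar>x $ 1\<bar> \<ge> 2 * radius t \<or> \<bar>x $ 2\<bar> \<ge> 2 * radius t" by (simp add: dist_norm) linarith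
      then show ?thesis by (auto simp: \<psi>_def stream_factors_outside[OF t])
    qed
    have "(\<integral>x. frechet_derivative \<phi> (at x) (vector [D\<psi> x (axis 2 1), - D\<psi> x (axis 1 1)]) \<partial>lborel) = 0"
      by (rule integral_skew_gradient_test_fun[OF d\<psi> cD compact_cball z \<phi>])
    moreover have "vector [D\<psi> x (axis 2 1), - D\<psi> x (axis 1 1)] = velocity t x" for x
      by (simp add: D\<psi>_def velocity_def vec_eq_iff forall_2 axis_def)
    ultimately show ?thesis by simp
  qed
qed

subsection \<open>The advected measure\<close>

text \<open>A series with an index range independent of \<open>t\<close>, valid at all times, from
  which joint measurability in time and label can be read off.\<close>

lemma vel_trajectory_suminf: "vel t (trajectory t \<theta>) = (\<Sum>j. dgap j t * cnt j \<theta>)"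
proof (cases "t > 0")
  case True
  have "(\<Sum>j. dgap j t * cnt j \<theta>) = (\<Sum>j<active t. dgap j t * cnt j \<theta>)"
  proof (rule suminf_finite)
    fix j assume "j \<notin> {..<active t}"
    then have "real (active t) * t \<le> real (j + 1) * t" using True by (intro mult_right_mono) auto
    with active_mult_ge_1[OF True] have "1 \<le> real (j + 1) * t" by linarith
    then show "dgap j t * cnt j \<theta> = 0" by (simp add: dgap_frozen)
  qed simp
  with vel_trajectory[OF True] show ?thesis by simp
next
  case False
  then have "real (j + 1) * t \<le> 0" for j by (simp add: mult_nonneg_nonpos)
  then have "dgap j t = 0" for j unfolding dgap_def by (simp add: dsstep_cases)
  then show ?thesis by (simp add: vel_def)
qed

lemma borel_measurable_cnt [measurable]: "cnt j \<in> borel_measurable borel"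
  unfolding cnt_def[abs_def] of_bool_def by measurable

lemma borel_measurable_gap [measurable]: "gap j \<in> borel_measurable borel" "dgap j \<in> borel_measurable borel"
  by (rule borel_measurable_continuous_onI, rule continuous_at_imp_continuous_on, rule ballI,
      rule lipschitz_near_imp_continuous, rule lipschitz_near_gap)+

lemma borel_measurable_trajectory [measurable]:
  "(\<lambda>p. trajectory (fst p) (snd p)) \<in> borel_measurable (borel \<Otimes>\<^sub>M borel)"
  unfolding trajectory_def by measurable

lemma borel_measurable_vel_trajectory [measurable]:
  "(\<lambda>p. vel (fst p) (trajectory (fst p) (snd p))) \<in> borel_measurable (borel \<Otimes>\<^sub>M borel)"
  unfolding vel_trajectory_suminf by measurable

text \<open>Each count is left-continuous, and the series converges uniformly in the label.
  Continuity from one side is what replaces continuity in the description of the support, since the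
  trajectories jump at the nodes.\<close>

lemma trajectory_tendsto_at_left: "(trajectory t \<longlongrightarrow> trajectory t \<theta>) (at_left \<theta>)"
proof -
  have cnt: "(cnt j \<longlongrightarrow> cnt j \<theta>) (at_left \<theta>)" for j
    unfolding cnt_def[abs_def]
  proof (intro tendsto_sum tendsto_eventually)
    fix k
    show "\<forall>\<^sub>F x in at_left \<theta>. of_bool (node j k < x) = (of_bool (node j k < \<theta>) :: real)"
    proof (cases "node j k < \<theta>")
      case True
      then have "\<forall>\<^sub>F x in at_left \<theta>. node j k < x" by (simp add: eventually_at_left_real order_tendstoD(1)[OF tendsto_ident_at])
      with True show ?thesis by (auto elim: eventually_mono)
    next
      case False
      have "\<forall>\<^sub>F x in at_left \<theta>. x < \<theta>" by (simp add: eventually_at_filter)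
      with False show ?thesis by (auto elim: eventually_mono)
    qed
  qed
  have "uniform_limit {..<\<theta>} (\<lambda>n x. \<Sum>j<n. gap j t * cnt j x) (\<lambda>x. \<Sum>j. gap j t * cnt j x) sequentially"
  proof (rule Weierstrass_m_test)
    show "norm (gap j t * cnt j x) \<le> 2 * t\<^sup>2 * (1 / (real (j + 1))\<^sup>2)" for j x
      using gap_cnt_le[of j t x] by (simp add: gap_nonneg cnt_nonneg)
  qed (intro summable_mult inverse_square_summable)
  moreover have "\<forall>\<^sub>F n in sequentially. ((\<lambda>x. \<Sum>j<n. gap j t * cnt j x) \<longlongrightarrow> (\<Sum>j<n. gap j t * cnt j \<theta>)) (at_left \<theta>)"
    by (intro always_eventually allI tendsto_sum tendsto_mult tendsto_const cnt)
  moreover have "(\<lambda>n. \<Sum>j<n. gap j t * cnt j \<theta>) \<longlonglongrightarrow> trajectory t \<theta>"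
    unfolding trajectory_def by (rule summable_LIMSEQ[OF gap_cnt_summable])
  ultimately have "((\<lambda>x. \<Sum>j. gap j t * cnt j x) \<longlongrightarrow> trajectory t \<theta>) (at_left \<theta>)"
    by (intro swap_uniform_limit[where F = sequentially]) auto
  then show ?thesis unfolding trajectory_def[abs_def] .
qed

text \<open>For large \<open>j\<close> the gap is frozen and the expression equals 2^(j (1 -
  \<alpha>)) / (j + 1)^(4 \<alpha>), which tends to infinity because \<alpha> < 1; the finitely many
  remaining values are positive.\<close>

lemma gap_powr_lower_bound:
  assumes t: "t > 0" and \<alpha>: "0 < \<alpha>" "\<alpha> < 1"
  obtains c where "c > 0" "\<And>j. c \<le> 2 ^ j * gap j t powr \<alpha>"
proof -
  define f where "f j = 2 ^ j * gap j t powr \<alpha>" for j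
  have f: "f j > 0" for j using gap_pos[OF t] by (simp add: f_def less_imp_neq[symmetric])
  obtain n where n: "1 / t < real n" using reals_Archimedean2 by blast
  have eq: "f j = 2 powr (real j * (1 - \<alpha>)) / (real j + 1) powr (4 * \<alpha>)" if "j \<ge> n" for j
  proof -
    have "1 / t < real (j + 1)" using n that by linarith
    then have "gap j t = 1 / (2 ^ j * real (j + 1) ^ 4)" using t by (intro gap_frozen) (simp add: field_simps)
    also have "\<dots> = 1 / (2 powr real j * (real j + 1) powr 4)"
      by (simp add: powr_realpow powr_numeral add.commute)
    finally have "gap j t powr \<alpha> = 1 / (2 powr (real j * \<alpha>) * (real j + 1) powr (4 * \<alpha>))"
      by (simp add: powr_divide powr_mult powr_powr del: powr_numeral)
    moreover have "2 powr (real j * (1 - \<alpha>)) = 2 ^ j / 2 powr (real j * \<alpha>)"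
      by (simp add: right_diff_distrib powr_diff powr_realpow)
    ultimately show ?thesis by (simp add: f_def)
  qed
  have "filterlim (\<lambda>j::nat. 2 powr (real j * (1 - \<alpha>)) / (real j + 1) powr (4 * \<alpha>)) at_top sequentially"
    using \<alpha> by real_asymp
  then have "\<forall>\<^sub>F j in sequentially. 1 \<le> 2 powr (real j * (1 - \<alpha>)) / (real j + 1) powr (4 * \<alpha>)"
    unfolding filterlim_at_top by blast
  then have "\<forall>\<^sub>F j in sequentially. 1 \<le> f j"
    using eventually_ge_at_top[of n] by eventually_elim (simp add: eq)
  then obtain N where N: "\<And>j. j \<ge> N \<Longrightarrow> 1 \<le> f j"
    by (auto simp: eventually_sequentially)
  define c where "c = Min (insert 1 (f ` {..<N}))"
  have "c > 0" using f by (auto simp: c_def)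
  moreover have "c \<le> f j" for j
  proof (cases "j < N")
    case True
    then show ?thesis unfolding c_def by (intro Min_le) auto
  next
    case False
    have "c \<le> 1" unfolding c_def by (intro Min_le) auto
    with N[of j] False show ?thesis by simp
  qed
  ultimately show thesis using that unfolding f_def by blast
qed

text \<open>Take the least \<open>j\<close> with 2^(-j) \<le> b - a. A node of generation
  \<open>j\<close> separates the labels, so their particles are at least \<open>gap j t\<close>
  apart, while b - a < 2 * 2^(-j) by minimality. \<open>gap_powr_lower_bound\<close> compares the
  two.\<close>

lemma trajectory_inverse_Hoelder:
  assumes t: "t > 0" and \<alpha>: "0 < \<alpha>" "\<alpha> < 1"
  obtains C where "\<And>a b. a \<in> {0<..<1} \<Longrightarrow> b \<in> {0<..<1} \<Longrightarrow> \<bar>a - b\<bar> \<le> C * \<bar>trajectory t a - trajectory t b\<bar> powr \<alpha>" "C > 0"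
proof -
  obtain c where c: "c > 0" "\<And>j. c \<le> 2 ^ j * gap j t powr \<alpha>"
    using gap_powr_lower_bound[OF t \<alpha>] by blast
  have less: "b - a \<le> 2 / c * \<bar>trajectory t a - trajectory t b\<bar> powr \<alpha>" if ab: "0 < a" "a < b" "b < 1" for a b
  proof -
    define P where "P j \<longleftrightarrow> 1 / 2 ^ j \<le> b - a" for j :: nat
    have "\<exists>j. (1/2) ^ j < b - a" using ab by (intro real_arch_pow_inv) auto
    then have ex: "\<exists>j. P j" by (auto simp: P_def power_divide intro: less_imp_le)
    define j where "j = (LEAST j. P j)"
    have j: "P j" unfolding j_def using ex by (rule LeastI_ex)
    \<comment> \<open>Here b - a < 1 enters; it leaves room for the predecessor of
      \<open>j\<close>.\<close>
    have "j \<noteq> 0" using j ab by (cases j) (auto simp: P_def)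
    then obtain i where i: "j = Suc i" by (cases j) auto
    have "\<not> P i" using not_less_Least[of i P] i by (simp add: j_def)
    then have "b - a < 2 / 2 ^ j" by (simp add: P_def i)
    moreover have "2 / 2 ^ j \<le> 2 / c * gap j t powr \<alpha>"
      using c(1) c(2)[of j] by (simp add: field_simps)
    moreover obtain k where k: "k < 2 ^ j" "a \<le> node j k" "node j k < b"
      using node_between[of a b j] ab j by (auto simp: P_def)
    have "gap j t \<le> \<bar>trajectory t a - trajectory t b\<bar>"
      using trajectory_jump[OF k, of t] by linarith
    then have "2 / c * gap j t powr \<alpha> \<le> 2 / c * \<bar>trajectory t a - trajectory t b\<bar> powr \<alpha>"
      using c(1) \<alpha> gap_nonneg by (intro mult_left_mono powr_mono2) auto
    ultimately show ?thesis by linarith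
  qed
  show thesis
  proof (rule that[of "2 / c"])
    fix a b :: real assume "a \<in> {0<..<1}" "b \<in> {0<..<1}"
    then show "\<bar>a - b\<bar> \<le> 2 / c * \<bar>trajectory t a - trajectory t b\<bar> powr \<alpha>"
      using less[of a b] less[of b a] c(1)
      by (cases a b rule: linorder_cases) (auto simp: abs_minus_commute)
  qed (use c in simp)
qed

definition embed :: "real \<Rightarrow> real \<times> real \<Rightarrow> real^2" where
  "embed t w = vector [trajectory t (fst w), trajectory t (snd w)]"

text \<open>The square is open, so that two labels differ by less than 1 in each coordinate and
  every label has a rectangle of positive mass to its lower left.\<close>

definition square_measure :: "(real \<times> real) measure" where
  "square_measure = restrict_space lborel ({0<..<1} \<times> {0<..<1})"

definition cloud :: "real \<Rightarrow> (real^2) measure" where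
  "cloud t = distr square_measure borel (embed t)"

section \<open>Mass and measurability\<close>

lemma emeasure_lborel_Times_greaterThanLessThan:
  fixes a b c d :: real
  assumes "a \<le> b" "c \<le> d"
  shows "emeasure lborel ({a<..<b} \<times> {c<..<d}) = ennreal ((b - a) * (d - c))"
  using assms
  by (simp add: lborel_prod[symmetric] lborel.emeasure_pair_measure_Times ennreal_mult)

lemma open_square: "open ({a<..<b::real} \<times> {c<..<d::real})"
  by (intro open_Times) auto

lemma borel_square [measurable]: "{a<..<b::real} \<times> {c<..<d::real} \<in> sets borel"
  by (rule borel_open[OF open_square])

lemma space_square_measure: "space square_measure = {0<..<1} \<times> {0<..<1}"
  by (simp add: square_measure_def space_restrict_space)

lemma emeasure_square_measure:
  assumes "0 \<le> a" "a \<le> b" "b \<le> 1" "0 \<le> c" "c \<le> d" "d \<le> 1"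
  shows "emeasure square_measure ({a<..<b} \<times> {c<..<d}) = ennreal ((b - a) * (d - c))"
  unfolding square_measure_def using assms borel_square[of 0 1 0 1]
  by (subst emeasure_restrict_space) (auto simp: emeasure_lborel_Times_greaterThanLessThan)

lemma emeasure_space_square_measure: "emeasure square_measure (space square_measure) = 1"
  unfolding space_square_measure using emeasure_square_measure[of 0 1 0 1] by simp

interpretation square: finite_measure square_measure
  by (rule finite_measureI) (simp add: emeasure_space_square_measure)

lemma measurable_square_measure:
  "f \<in> borel_measurable borel \<Longrightarrow> f \<in> borel_measurable square_measure"
  unfolding square_measure_def by (intro measurable_restrict_space1) simp

lemma measurable_fst_snd_square [measurable]:
  "fst \<in> borel_measurable square_measure" "snd \<in> borel_measurable square_measure"
  by (intro measurable_square_measure borel_measurable_continuous_onI continuous_intros)+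

lemma measurable_embed_pair:
  "(\<lambda>p. embed (fst p) (snd p)) \<in> borel_measurable (borel \<Otimes>\<^sub>M square_measure)"
proof -
  have "(\<lambda>p. trajectory (fst p) (g (snd p))) \<in> borel_measurable (borel \<Otimes>\<^sub>M square_measure)"
    if "g \<in> borel_measurable square_measure" for g
    using measurable_compose[OF measurable_Pair[OF measurable_fst measurable_compose[OF measurable_snd that]] borel_measurable_trajectory]
    by simp
  then show ?thesis
    unfolding embed_def vector_2_eq
    by (intro borel_measurable_add borel_measurable_scaleR borel_measurable_const) simp_all
qed

lemma measurable_embed [measurable]: "embed t \<in> borel_measurable square_measure"
  using measurable_compose[OF measurable_Pair1' measurable_embed_pair, of t] by simp

lemma emeasure_cloud:
  "A \<in> sets borel \<Longrightarrow> emeasure (cloud t) A = emeasure square_measure (embed t -` A \<inter> space square_measure)"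
  unfolding cloud_def by (rule emeasure_distr[OF measurable_embed])

lemma integral_cloud:
  fixes f :: "real^2 \<Rightarrow> real"
  shows "f \<in> borel_measurable borel \<Longrightarrow> (\<integral>x. f x \<partial>(cloud t)) = (\<integral>w. f (embed t w) \<partial>square_measure)"
  unfolding cloud_def by (rule integral_distr[OF measurable_embed])

lemma embed_0 [simp]: "embed 0 w = 0"
  by (simp add: embed_def vec_eq_iff forall_2)

lemma cloud_locally_finite: "locally_finite_borel (cloud t)"
  unfolding locally_finite_borel_def
proof (intro conjI allI exI[of _ 1])
  fix x
  have "emeasure (cloud t) (ball x 1) \<le> emeasure square_measure (space square_measure)"
    by (simp add: emeasure_cloud emeasure_space)
  then show "emeasure (cloud t) (ball x 1) < \<infinity>"
    by (simp add: emeasure_space_square_measure order_le_less_trans)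
qed (simp_all add: cloud_def)

section \<open>The support of the measure and its dimension\<close>

lemma msupp_cloud_0: "msupp (cloud 0) = {0}"
proof (intro set_eqI iffI)
  fix x :: "real^2"
  assume x: "x \<in> msupp (cloud 0)"
  show "x \<in> {0}"
  proof (rule ccontr)
    assume "x \<notin> {0}"
    then have "emeasure (cloud 0) (ball x (norm x)) = 0" "norm x > 0"
      by (simp_all add: emeasure_cloud vimage_def)
    moreover have "0 < emeasure (cloud 0) (ball x e)" if "e > 0" for e
      using x that by (simp add: msupp_def)
    ultimately show False by (metis less_irrefl)
  qed
next
  fix x :: "real^2"
  assume "x \<in> {0}"
  then show "x \<in> msupp (cloud 0)"
    by (auto simp: msupp_def emeasure_cloud vimage_def emeasure_space_square_measure)
qed

lemma msupp_cloud_subset: "msupp (cloud t) \<subseteq> {x. \<forall>i. 0 \<le> x $ i \<and> x $ i < radius t + 1}"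
proof (intro subsetI CollectI allI, rule ccontr)
  fix x i assume "x \<in> msupp (cloud t)" "\<not> (0 \<le> x $ i \<and> x $ i < radius t + 1)"
  then have x: "x \<in> msupp (cloud t)" "x $ i < 0 \<or> x $ i \<ge> radius t + 1" by linarith+
  \<comment> \<open>A lower bound for the distance of \<open>x\<close> from the strip in which the
    i-th coordinate of every particle lies.\<close>
  define e where "e = (if x $ i < 0 then - x $ i else 1)"
  have e: "e > 0" using x(2) by (auto simp: e_def)
  have "embed t w \<notin> ball x e" for w
  proof
    assume "embed t w \<in> ball x e"
    then have "\<bar>x $ i - embed t w $ i\<bar> < e"
      using dist_vec_nth_le[of x i "embed t w"] by (simp add: dist_real_def)
    moreover have "i = 1 \<or> i = 2" using exhaust_2 by blast
    then have "0 \<le> embed t w $ i" "embed t w $ i \<le> radius t"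
      by (auto simp: embed_def trajectory_nonneg trajectory_le radius_def)
    ultimately show False using x(2) by (auto simp: e_def split: if_splits)
  qed
  then have "emeasure (cloud t) (ball x e) = 0" by (simp add: emeasure_cloud vimage_def)
  with x(1) e show False by (auto simp: msupp_def)
qed

text \<open>The map \<open>embed t\<close> is discontinuous, but left continuity in each label sends
  a small rectangle to the lower left of \<open>w\<close> into any given ball, and that rectangle
  has positive mass.\<close>

lemma embed_in_msupp_cloud:
  assumes "w \<in> {0<..<1} \<times> {0<..<1}"
  shows "embed t w \<in> msupp (cloud t)"
  unfolding msupp_def
proof (intro CollectI allI impI)
  fix e :: real assume e: "e > 0"
  have "\<exists>l. 0 \<le> l \<and> l < \<theta> \<and> (\<forall>y. l < y \<longrightarrow> y < \<theta> \<longrightarrow> \<bar>trajectory t y - trajectory t \<theta>\<bar> < e / 2)" if "0 < \<theta>" for \<theta>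
  proof -
    have "\<forall>\<^sub>F y in at_left \<theta>. dist (trajectory t y) (trajectory t \<theta>) < e / 2"
      using tendstoD[OF trajectory_tendsto_at_left, of "e / 2"] e by simp
    then obtain b where "b < \<theta>" "\<And>y. b < y \<Longrightarrow> y < \<theta> \<Longrightarrow> dist (trajectory t y) (trajectory t \<theta>) < e / 2"
      by (auto simp: eventually_at_left_field)
    with that show ?thesis by (intro exI[of _ "max 0 b"]) (auto simp: dist_real_def)
  qed
  from this[of "fst w"] this[of "snd w"] obtain l m where
    l: "0 \<le> l" "l < fst w" "\<And>y. l < y \<Longrightarrow> y < fst w \<Longrightarrow> \<bar>trajectory t y - trajectory t (fst w)\<bar> < e / 2" and
    m: "0 \<le> m" "m < snd w" "\<And>y. m < y \<Longrightarrow> y < snd w \<Longrightarrow> \<bar>trajectory t y - trajectory t (snd w)\<bar> < e / 2"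
    using assms by auto
  have sub: "{l<..<fst w} \<times> {m<..<snd w} \<subseteq> embed t -` ball (embed t w) e \<inter> space square_measure"
  proof
    fix v assume v: "v \<in> {l<..<fst w} \<times> {m<..<snd w}"
    have "dist (embed t w) (embed t v) \<le> \<bar>trajectory t (fst v) - trajectory t (fst w)\<bar> + \<bar>trajectory t (snd v) - trajectory t (snd w)\<bar>"
      using norm_le_l1_cart[of "embed t v - embed t w"]
      by (simp add: dist_norm norm_minus_commute sum_2 embed_def)
    also have "\<dots> < e / 2 + e / 2" using v by (intro add_strict_mono l(3) m(3)) auto
    finally show "v \<in> embed t -` ball (embed t w) e \<inter> space square_measure"
      using v l m assms by (auto simp: space_square_measure)
  qed
  have "0 < emeasure square_measure ({l<..<fst w} \<times> {m<..<snd w})"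
    using l m assms by (subst emeasure_square_measure) auto
  also have "\<dots> \<le> emeasure square_measure (embed t -` ball (embed t w) e \<inter> space square_measure)"
    by (rule emeasure_mono[OF sub]) (auto intro: measurable_sets[OF measurable_embed])
  also have "\<dots> = emeasure (cloud t) (ball (embed t w) e)" by (simp add: emeasure_cloud)
  finally show "0 < emeasure (cloud t) (ball (embed t w) e)" .
qed

lemma hausdorff_dim_msupp_cloud:
  assumes t: "t > 0"
  shows "hausdorff_dim (msupp (cloud t)) = 2"
proof (rule hausdorff_dim_planar_eq_2[OF msupp_cloud_subset])
  fix s :: real assume s: "0 < s" "s < 2"
  \<comment> \<open>The label square has dimension 2, so the principle yields the exponent 2
    \<alpha> = s.\<close>
  define \<alpha> where "\<alpha> = s / 2"
  have \<alpha>: "0 < \<alpha>" "\<alpha> < 1" using s by (auto simp: \<alpha>_def)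
  obtain C where C: "\<And>a b. a \<in> {0<..<1} \<Longrightarrow> b \<in> {0<..<1} \<Longrightarrow> \<bar>a - b\<bar> \<le> C * \<bar>trajectory t a - trajectory t b\<bar> powr \<alpha>" "C > 0"
    using trajectory_inverse_Hoelder[OF t \<alpha>] by blast
  have "hausdorff_measure (real DIM(real \<times> real) * \<alpha>) (msupp (cloud t)) > 0"
  proof (rule hausdorff_measure_pos_if_inverse_Hoelder[where S = "{0<..<1} \<times> {0<..<1}" and f = "embed t" and C = "2 * C"])
    show "emeasure lborel ({0<..<1::real} \<times> {0<..<1::real}) > 0"
      by (subst emeasure_lborel_Times_greaterThanLessThan) auto
    fix v w :: "real \<times> real" assume vw: "v \<in> {0<..<1} \<times> {0<..<1}" "w \<in> {0<..<1} \<times> {0<..<1}"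
    have "dist v w \<le> \<bar>fst v - fst w\<bar> + \<bar>snd v - snd w\<bar>"
      using sqrt_sum_squares_le_sum_abs[of "fst v - fst w" "snd v - snd w"]
      by (simp add: dist_prod_def dist_real_def)
    also have "\<dots> \<le> C * \<bar>trajectory t (fst v) - trajectory t (fst w)\<bar> powr \<alpha> + C * \<bar>trajectory t (snd v) - trajectory t (snd w)\<bar> powr \<alpha>"
      using vw by (intro add_mono C) auto
    also have "\<dots> \<le> C * dist (embed t v) (embed t w) powr \<alpha> + C * dist (embed t v) (embed t w) powr \<alpha>"
      using C(2) \<alpha> dist_vec_nth_le[of "embed t v" 1 "embed t w"] dist_vec_nth_le[of "embed t v" 2 "embed t w"]
      by (intro add_mono mult_left_mono powr_mono2) (auto simp: embed_def dist_real_def)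
    finally show "dist v w \<le> 2 * C * dist (embed t v) (embed t w) powr \<alpha>" by simp
  qed (use \<alpha> embed_in_msupp_cloud in auto)
  then show "hausdorff_measure s (msupp (cloud t)) > 0" by (simp add: \<alpha>_def)
qed

section \<open>Weak advection\<close>

lemma test_fun_derivative_bounded:
  assumes "test_fun \<phi>"
  obtains M where "M \<ge> 0" "\<And>p. \<bar>frechet_derivative \<phi> (at p) v\<bar> \<le> M"
proof -
  obtain K where K: "compact K" "\<And>x v. x \<notin> K \<Longrightarrow> frechet_derivative \<phi> (at x) v = 0"
    using test_fun_compact_supportE[OF assms] by metis
  have "bounded ((\<lambda>x. frechet_derivative \<phi> (at x) v) ` K)"
    by (intro compact_imp_bounded compact_continuous_image K(1)
        continuous_on_subset[OF test_fun_derivative_continuous[OF assms]]) auto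
  then obtain M where M: "\<And>x. x \<in> K \<Longrightarrow> \<bar>frechet_derivative \<phi> (at x) v\<bar> \<le> M"
    by (auto simp: bounded_iff)
  have "\<bar>frechet_derivative \<phi> (at p) v\<bar> \<le> max 0 M" for p
    using M[of p] K(2)[of p v] by (cases "p \<in> K") auto
  then show thesis using that[of "max 0 M"] by simp
qed

lemma test_fun_derivative_linear: "test_fun \<phi> \<Longrightarrow> linear (frechet_derivative \<phi> (at p))"
  by (rule bounded_linear.linear[OF has_derivative_bounded_linear[OF test_fun_has_derivative]])

lemma embed_continuous_in_time: "continuous_on UNIV (\<lambda>t. embed t w)"
  unfolding embed_def vector_2_eq
  by (intro continuous_intros lipschitz_on_continuous_on[OF trajectory_lipschitz])

text \<open>The chain rule along a particle path: the integrand of the weak formulation is an exact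
  time derivative.\<close>

lemma has_real_derivative_along_embed:
  fixes \<phi> :: "real \<times> (real^2) \<Rightarrow> real"
  assumes \<phi>: "test_fun \<phi>" and t: "t > 0"
  shows "((\<lambda>t. \<phi> (t, embed t w)) has_real_derivative
     frechet_derivative \<phi> (at (t, embed t w)) (1, 0) +
     frechet_derivative \<phi> (at (t, embed t w)) (0, velocity t (embed t w))) (at t)"
proof -
  define a b where "a = vel t (trajectory t (fst w))" and "b = vel t (trajectory t (snd w))"
  define D where "D = frechet_derivative \<phi> (at (t, embed t w))"
  have lin: "linear D" unfolding D_def by (rule test_fun_derivative_linear[OF \<phi>])
  have v: "velocity t (embed t w) = a *\<^sub>R axis 1 1 + b *\<^sub>R axis 2 1"
    by (simp add: embed_def velocity_at_trajectory[OF t] a_def b_def flip: vector_2_eq)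
  have p: "((\<lambda>t. trajectory t (fst w)) has_derivative (\<lambda>h. a * h)) (at t)"
    "((\<lambda>t. trajectory t (snd w)) has_derivative (\<lambda>h. b * h)) (at t)"
    using trajectory_has_real_derivative_vel[OF t] by (simp_all add: has_field_derivative_def a_def b_def)
  have "((\<lambda>t. (t, embed t w)) has_derivative (\<lambda>h. (h, (a * h) *\<^sub>R axis 1 1 + (b * h) *\<^sub>R axis 2 1))) (at t)"
    unfolding embed_def vector_2_eq
    by (intro has_derivative_Pair has_derivative_add has_derivative_scaleR_left has_derivative_ident p)
  from has_derivative_compose[OF this test_fun_has_derivative[OF \<phi>]]
  have "((\<lambda>t. \<phi> (t, embed t w)) has_derivative (\<lambda>h. D (h, (a * h) *\<^sub>R axis 1 1 + (b * h) *\<^sub>R axis 2 1))) (at t)"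
    by (simp add: D_def)
  moreover have "D (h, (a * h) *\<^sub>R axis 1 1 + (b * h) *\<^sub>R axis 2 1) = (D (1, 0) + D (0, velocity t (embed t w))) * h" for h
  proof -
    have "(h, (a * h) *\<^sub>R axis 1 1 + (b * h) *\<^sub>R axis 2 1) = h *\<^sub>R (1, 0) + h *\<^sub>R (0, velocity t (embed t w))"
      by (simp add: v scaleR_add_right mult.commute)
    then show ?thesis
      by (simp only: linear_add[OF lin] linear_cmul[OF lin]) (simp add: algebra_simps)
  qed
  ultimately show ?thesis by (simp add: has_field_derivative_def D_def)
qed

text \<open>In labels, the two time integrals become one integral over paths of the derivative of
  the test function along the path; the fundamental theorem evaluates it path by path, and Fubini
  exchanges time and labels.\<close>

lemma cloud_weakly_advected:
  assumes T: "T > 0"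
  shows "weakly_advected velocity cloud T"
  unfolding weakly_advected_def Let_def
proof (intro allI impI)
  fix \<phi> :: "real \<times> (real^2) \<Rightarrow> real" assume \<phi>: "test_fun \<phi>"
  define D where "D p = frechet_derivative \<phi> (at p)" for p
  define L where "L = restrict_space lborel {0..T}"
  define A where "A t w = D (t, embed t w) (1, 0)" for t w
  \<comment> \<open>The advection term expressed through \<open>vel\<close> along trajectories,
    whose joint measurability is known. It agrees with the derivative along \<open>velocity\<close>
    at nonnegative times.\<close>
  define B where "B t w = vel t (trajectory t (fst w)) * D (t, embed t w) (0, axis 1 1)
      + vel t (trajectory t (snd w)) * D (t, embed t w) (0, axis 2 1)" for t w
  note lin = test_fun_derivative_linear[OF \<phi>, folded D_def]
  note Dc = test_fun_derivative_continuous[OF \<phi>, folded D_def]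
  have dt: "(\<integral>x. frechet_derivative \<phi> (at (t, x)) (1, 0) \<partial>(cloud t)) = (\<integral>w. A t w \<partial>square_measure)" for t
  proof -
    have "continuous_on UNIV (\<lambda>x. D (t, x) (1, 0))"
      by (rule continuous_on_compose2[OF Dc]) (auto intro!: continuous_intros)
    then show ?thesis
      unfolding A_def D_def[symmetric] by (intro integral_cloud borel_measurable_continuous_onI)
  qed
  have adv: "(\<integral>x. frechet_derivative \<phi> (at (t, x)) (0, velocity t x) \<partial>(cloud t)) = (\<integral>w. B t w \<partial>square_measure)"
    and B: "B t w = D (t, embed t w) (0, velocity t (embed t w))" if t: "t \<ge> 0" for t w
  proof -
    have ex: "D p (0, v) = v $ 1 * D p (0, axis 1 1) + v $ 2 * D p (0, axis 2 1)" for p v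
    proof -
      have "(0, v) = v $ 1 *\<^sub>R (0, axis 1 1) + v $ 2 *\<^sub>R (0 :: real, axis 2 1 :: real^2)"
        by (simp add: vec_eq_iff forall_2 axis_def)
      then show ?thesis by (simp only: linear_add[OF lin] linear_cmul[OF lin]) simp
    qed
    show B: "B t w = D (t, embed t w) (0, velocity t (embed t w))" for w
    proof (cases "t = 0")
      case True
      have "vel 0 x = 0" for x by (simp add: vel_def active_def)
      moreover have "D p (0, 0) = 0" for p using linear_0[OF lin] by (simp add: zero_prod_def)
      ultimately show ?thesis by (simp add: B_def True)
    next
      case False
      with t have "t > 0" by simp
      then show ?thesis
        unfolding ex[of _ "velocity t (embed t w)"] by (simp add: B_def embed_def velocity_at_trajectory)
    qed
    have "continuous_on UNIV (\<lambda>x. (\<lambda>(t, x). velocity t x) (t, x))"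
      by (rule continuous_on_compose2[OF uniformly_continuous_imp_continuous[OF velocity_uniformly_continuous]])
         (use t in \<open>auto intro!: continuous_intros\<close>)
    then have "continuous_on UNIV (\<lambda>x. D (t, x) (0, velocity t x))"
      unfolding ex[of _ "velocity t x" for x]
      by (intro continuous_intros continuous_on_compose2[OF Dc]) auto
    then show "(\<integral>x. frechet_derivative \<phi> (at (t, x)) (0, velocity t x) \<partial>(cloud t)) = (\<integral>w. B t w \<partial>square_measure)"
      unfolding B D_def[symmetric] by (intro integral_cloud borel_measurable_continuous_onI)
  qed
  interpret L: finite_measure L
    by (rule finite_measureI) (use T in \<open>simp add: L_def emeasure_restrict_space space_restrict_space\<close>)
  interpret P: pair_sigma_finite L square_measure ..
  interpret PF: finite_measure "L \<Otimes>\<^sub>M square_measure"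
    by (intro finite_measure_pair_measure L.finite_measure_axioms square.finite_measure_axioms)
  \<comment> \<open>The measure \<open>L\<close> carries the sets of the restricted space; this
    transfers measurability stated with all of \<open>borel\<close> for the time variable.\<close>
  have idL: "(\<lambda>p. p) \<in> L \<Otimes>\<^sub>M square_measure \<rightarrow>\<^sub>M borel \<Otimes>\<^sub>M square_measure"
  proof -
    have "(\<lambda>t. t) \<in> L \<rightarrow>\<^sub>M borel" unfolding L_def by (intro measurable_restrict_space1) simp
    then have "(\<lambda>p. (fst p, snd p)) \<in> L \<Otimes>\<^sub>M square_measure \<rightarrow>\<^sub>M borel \<Otimes>\<^sub>M square_measure"
      by (intro measurable_Pair measurable_compose[OF measurable_fst] measurable_snd)
    then show ?thesis by simp
  qed
  have mD: "(\<lambda>p. D (fst p, embed (fst p) (snd p)) v) \<in> borel_measurable (borel \<Otimes>\<^sub>M square_measure)" for v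
    by (rule measurable_compose[OF borel_measurable_Pair[OF measurable_fst measurable_embed_pair]
          borel_measurable_continuous_onI[OF Dc]])
  have mv: "(\<lambda>p. vel (fst p) (trajectory (fst p) (g (snd p)))) \<in> borel_measurable (borel \<Otimes>\<^sub>M square_measure)"
    if "g \<in> borel_measurable square_measure" for g
    using measurable_compose[OF measurable_Pair[OF measurable_fst measurable_compose[OF measurable_snd that]] borel_measurable_vel_trajectory]
    by simp
  have mA: "(\<lambda>(t, w). A t w) \<in> borel_measurable (L \<Otimes>\<^sub>M square_measure)"
    using measurable_compose[OF idL mD] by (simp add: A_def case_prod_unfold)
  have mB: "(\<lambda>(t, w). B t w) \<in> borel_measurable (L \<Otimes>\<^sub>M square_measure)"
    unfolding B_def case_prod_unfold
    by (rule measurable_compose[OF idL]) (intro borel_measurable_add borel_measurable_times mD mv measurable_fst_snd_square)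
  obtain M0 where M0: "M0 \<ge> 0" "\<And>p. \<bar>D p (1, 0)\<bar> \<le> M0"
    using test_fun_derivative_bounded[OF \<phi>] unfolding D_def by metis
  obtain M1 where M1: "M1 \<ge> 0" "\<And>p. \<bar>D p (0, axis 1 1)\<bar> \<le> M1"
    using test_fun_derivative_bounded[OF \<phi>] unfolding D_def by metis
  obtain M2 where M2: "M2 \<ge> 0" "\<And>p. \<bar>D p (0, axis 2 1)\<bar> \<le> M2"
    using test_fun_derivative_bounded[OF \<phi>] unfolding D_def by metis
  define V where "V = 4 * width_const * T"
  have V: "\<bar>vel t x\<bar> \<le> V" if t: "t \<in> {0..T}" for t x
  proof (cases "t = 0")
    case True
    then show ?thesis using T width_const_pos by (simp add: vel_def active_def V_def)
  next
    case False
    with t have t0: "t > 0" by simp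
    have "vel t x \<le> 2 / t * radius t"
      using vel_le_total_rate total_rate_le[OF t0] by (rule order_trans)
    also have "\<dots> = 4 * width_const * t" using t0 by (simp add: radius_def power2_eq_square)
    also have "\<dots> \<le> V" unfolding V_def using t width_const_pos by (intro mult_left_mono) auto
    finally show ?thesis by (simp add: vel_nonneg)
  qed
  have V0: "V \<ge> 0" using T width_const_pos by (simp add: V_def)
  have bB: "\<bar>B t w\<bar> \<le> V * M1 + V * M2" if t: "t \<in> {0..T}" for t w
  proof -
    have "\<bar>B t w\<bar> \<le> \<bar>vel t (trajectory t (fst w))\<bar> * \<bar>D (t, embed t w) (0, axis 1 1)\<bar>
        + \<bar>vel t (trajectory t (snd w))\<bar> * \<bar>D (t, embed t w) (0, axis 2 1)\<bar>"
      unfolding B_def by (rule order_trans[OF abs_triangle_ineq]) (simp add: abs_mult)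
    also have "\<dots> \<le> V * M1 + V * M2"
      using V0 by (intro add_mono mult_mono V M1 M2 t) auto
    finally show ?thesis .
  qed
  have spL: "space (L \<Otimes>\<^sub>M square_measure) = {0..T} \<times> space square_measure"
    by (simp add: space_pair_measure L_def space_restrict_space)
  have iA: "integrable (L \<Otimes>\<^sub>M square_measure) (\<lambda>(t, w). A t w)"
    by (rule PF.integrable_const_bound[OF _ mA, of M0]) (simp add: A_def M0 case_prod_unfold)
  have iB: "integrable (L \<Otimes>\<^sub>M square_measure) (\<lambda>(t, w). B t w)"
    by (rule PF.integrable_const_bound[OF AE_I2 mB, of "V * M1 + V * M2"]) (auto simp: spL bB)
  have set_L: "set_integrable lborel {0..T} f \<longleftrightarrow> integrable L f"
    "(LINT t:{0..T}|lborel. f t) = (\<integral>t. f t \<partial>L)" for f :: "real \<Rightarrow> real"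
    by (simp_all add: L_def integrable_restrict_space integral_restrict_space set_integrable_def set_lebesgue_integral_def)
  have ftc: "(\<integral>t. A t w + B t w \<partial>L) = \<phi> (T, embed T w) - \<phi> (0, 0)" if w: "w \<in> space square_measure" for w
  proof -
    have m: "(\<lambda>t. A t w) \<in> borel_measurable L" "(\<lambda>t. B t w) \<in> borel_measurable L"
      using measurable_compose[OF measurable_Pair2'[OF w] mA] measurable_compose[OF measurable_Pair2'[OF w] mB]
      by simp_all
    have "integrable L (\<lambda>t. A t w)"
      by (rule L.integrable_const_bound[OF _ m(1), of M0]) (simp add: A_def M0)
    moreover have "integrable L (\<lambda>t. B t w)"
      by (rule L.integrable_const_bound[OF AE_I2 m(2), of "V * M1 + V * M2"])
         (simp add: L_def space_restrict_space bB)
    ultimately have "integrable L (\<lambda>t. A t w + B t w)" by simp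
    then have int: "set_integrable lborel {0..T} (\<lambda>t. A t w + B t w)" by (simp add: set_L)
    have "((\<lambda>t. A t w + B t w) has_integral \<phi> (T, embed T w) - \<phi> (0, embed 0 w)) {0..T}"
    \<comment> \<open>The derivative along a path is available for positive times only; at time 0
      continuity takes its place.\<close>
    proof (rule fundamental_theorem_of_calculus_interior)
      have "continuous_on UNIV \<phi>"
        by (rule continuous_on_UNIV_has_derivative[OF test_fun_has_derivative[OF \<phi>]])
      then show "continuous_on {0..T} (\<lambda>t. \<phi> (t, embed t w))"
        by (rule continuous_on_compose2)
           (auto intro!: continuous_intros continuous_on_subset[OF embed_continuous_in_time])
      fix t assume "t \<in> {0<..<T}"
      then have "t > 0" by simp
      from has_real_derivative_along_embed[OF \<phi> this, of w]
      show "((\<lambda>t. \<phi> (t, embed t w)) has_vector_derivative A t w + B t w) (at t)"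
        using \<open>t > 0\<close> by (simp add: A_def B D_def has_real_derivative_iff_has_vector_derivative)
    qed (use T in simp)
    then show ?thesis
      using set_borel_integral_eq_integral(2)[OF int] by (simp add: set_L integral_unique)
  qed
  have \<phi>c: "continuous_on UNIV (\<lambda>x. \<phi> (t, x))" for t
    by (rule continuous_on_compose2[OF continuous_on_UNIV_has_derivative[OF test_fun_has_derivative[OF \<phi>]]])
       (auto intro!: continuous_intros)
  have \<phi>i: "(\<integral>x. \<phi> (t, x) \<partial>(cloud t)) = (\<integral>w. \<phi> (t, embed t w) \<partial>square_measure)" for t
    by (intro integral_cloud borel_measurable_continuous_onI \<phi>c)
  obtain C where C: "\<And>p. \<bar>\<phi> p\<bar> \<le> C"
  proof -
    obtain K where K: "compact K" "\<And>x. x \<notin> K \<Longrightarrow> \<phi> x = 0"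
      using test_fun_compact_supportE[OF \<phi>] by metis
    have "bounded (\<phi> ` K)"
      by (intro compact_imp_bounded compact_continuous_image K(1)
        continuous_on_subset[OF continuous_on_UNIV_has_derivative[OF test_fun_has_derivative[OF \<phi>]]]) auto
    then obtain c where c: "\<And>x. x \<in> K \<Longrightarrow> \<bar>\<phi> x\<bar> \<le> c" by (auto simp: bounded_iff)
    have "\<bar>\<phi> p\<bar> \<le> max 0 c" for p using c[of p] K(2)[of p] by (cases "p \<in> K") auto
    then show thesis by (rule that)
  qed
  have i\<phi>: "integrable square_measure (\<lambda>w. \<phi> (t, embed t w))" for t
  proof (rule square.integrable_const_bound[of _ C])
    show "(\<lambda>w. \<phi> (t, embed t w)) \<in> borel_measurable square_measure"
      by (rule measurable_compose[OF measurable_embed borel_measurable_continuous_onI[OF \<phi>c]])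
  qed (simp add: C)
  have iA': "integrable L (\<lambda>t. \<integral>w. A t w \<partial>square_measure)"
    and iB': "integrable L (\<lambda>t. \<integral>w. B t w \<partial>square_measure)"
    using P.integrable_fst[OF iA] P.integrable_fst[OF iB] by simp_all
  have iAB: "integrable (L \<Otimes>\<^sub>M square_measure) (\<lambda>(t, w). A t w + B t w)"
    using Bochner_Integration.integrable_add[OF iA iB] by (simp add: case_prod_unfold)
  have "(\<integral>t. (\<integral>w. A t w \<partial>square_measure) \<partial>L) + (\<integral>t. (\<integral>w. B t w \<partial>square_measure) \<partial>L)
      = (\<integral>p. (\<lambda>(t, w). A t w) p + (\<lambda>(t, w). B t w) p \<partial>(L \<Otimes>\<^sub>M square_measure))"
    using Bochner_Integration.integral_add[OF iA iB] P.integral_fst[OF iA] P.integral_fst[OF iB] by simp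
  also have "\<dots> = (\<integral>w. (\<integral>t. A t w + B t w \<partial>L) \<partial>square_measure)"
    using P.integral_snd[OF iAB] by (simp add: case_prod_unfold)
  also have "\<dots> = (\<integral>w. \<phi> (T, embed T w) - \<phi> (0, embed 0 w) \<partial>square_measure)"
    by (rule Bochner_Integration.integral_cong) (simp_all add: ftc)
  also have "\<dots> = (\<integral>x. \<phi> (T, x) \<partial>(cloud T)) - (\<integral>x. \<phi> (0, x) \<partial>(cloud 0))"
    unfolding \<phi>i by (rule Bochner_Integration.integral_diff[OF i\<phi> i\<phi>])
  finally have main: "(\<integral>t. (\<integral>w. A t w \<partial>square_measure) \<partial>L) + (\<integral>t. (\<integral>w. B t w \<partial>square_measure) \<partial>L)
      = (\<integral>x. \<phi> (T, x) \<partial>(cloud T)) - (\<integral>x. \<phi> (0, x) \<partial>(cloud 0))" .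
  \<comment> \<open>The two integrands have been identified for nonnegative times only, so the
    congruence is taken over the space of \<open>L\<close>.\<close>
  have advL: "integrable L (\<lambda>t. \<integral>x. frechet_derivative \<phi> (at (t, x)) (0, velocity t x) \<partial>(cloud t))
      \<longleftrightarrow> integrable L (\<lambda>t. \<integral>w. B t w \<partial>square_measure)"
    "(\<integral>t. (\<integral>x. frechet_derivative \<phi> (at (t, x)) (0, velocity t x) \<partial>(cloud t)) \<partial>L)
      = (\<integral>t. (\<integral>w. B t w \<partial>square_measure) \<partial>L)"
    by (intro Bochner_Integration.integrable_cong Bochner_Integration.integral_cong;
        simp add: L_def space_restrict_space adv)+
  show "set_integrable lborel {0..T} (\<lambda>t. \<integral>x. frechet_derivative \<phi> (at (t, x)) (1, 0) \<partial>(cloud t)) \<and>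
      set_integrable lborel {0..T} (\<lambda>t. \<integral>x. frechet_derivative \<phi> (at (t, x)) (0, velocity t x) \<partial>(cloud t)) \<and>
      (LINT t:{0..T}|lborel. \<integral>x. frechet_derivative \<phi> (at (t, x)) (1, 0) \<partial>(cloud t))
      - (\<integral>x. \<phi> (T, x) \<partial>(cloud T)) + (\<integral>x. \<phi> (0, x) \<partial>(cloud 0))
      + (LINT t:{0..T}|lborel. \<integral>x. frechet_derivative \<phi> (at (t, x)) (0, velocity t x) \<partial>(cloud t)) = 0"
    unfolding set_L advL dt using iA' iB' main by simp
qed

theorem theorem2:
  shows "\<exists>(u :: real \<Rightarrow> real^2 \<Rightarrow> real^2) (\<omega> :: real \<Rightarrow> (real^2) measure).
    uniformly_continuous_on ({0..} \<times> UNIV) (\<lambda>(t, x). u t x) \<and>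
    (\<exists>K. compact K \<and> (\<forall>t\<ge>0. \<forall>x. (t, x) \<notin> K \<longrightarrow> u t x = 0)) \<and>
    weakly_div_free u \<and>
    (\<forall>t\<ge>0. locally_finite_borel (\<omega> t)) \<and>
    (\<forall>T>0. weakly_advected u \<omega> T) \<and>
    msupp (\<omega> 0) = {0} \<and>
    (\<forall>t>0. hausdorff_dim (msupp (\<omega> t)) = 2) \<and>
    locally_lipschitz_on ({0..} \<times> (UNIV - {0})) (\<lambda>(t, x). u t x)"
proof -
  obtain K where "compact K" "\<And>t x. t \<ge> 0 \<Longrightarrow> (t, x) \<notin> K \<Longrightarrow> velocity t x = 0"
    using velocity_compact_support by blast
  then have "\<exists>K. compact K \<and> (\<forall>t\<ge>0. \<forall>x. (t, x) \<notin> K \<longrightarrow> velocity t x = 0)" by blast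
  then show ?thesis
    by (intro exI[of _ velocity] exI[of _ cloud] conjI allI impI velocity_uniformly_continuous
        velocity_weakly_div_free cloud_locally_finite cloud_weakly_advected msupp_cloud_0
        hausdorff_dim_msupp_cloud velocity_locally_lipschitz)
qed

end
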